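(* Let $\mathcal{C}$ be a class of topological semigroups such that $\mathsf{T}_{\mathsf z}\mathsf{S}\subseteq\mathcal{C}\subseteq\mathsf{T}_1\mathsf{S}$. The center $Z(X)$ of an absolutely $\mathcal{C}$-closed unipotent semigroup $X$ is finite and hence absolutely $\mathcal{C}$-closed.
   Context: A topological semigroup is a topological space $X$ endowed with a continuous associative binary operation $X\times X\to X$, $(x,y)\mapsto xy$. $\mathsf{T}_1\mathsf{S}$ denotes the class of topological semigroups satisfying the separation axiom $T_1$ (all finite subsets are closed). $\mathsf{T}_{\mathsf z}\mathsf{S}$ denotes the class of Hausdorff zero-dimensional topological semigroups, where a space is zero-dimensional if it has a base of the topology consisting of clopen sets. A topological semigroup $X$ is absolutely $\mathcal{C}$-closed if for any continuous homomorphism $h:X\to Y$ (not necessarily injective) to a topological semigroup $Y\in\mathcal{C}$ the image $h[X]$ is closed in $Y$. A semigroup $X$ (without topology) is absolutely $\mathcal{C}$-closed if $X$ endowed with the discrete topology is absolutely $\mathcal{C}$-closed. A semigroup is unipotent if it contains a unique idempotent. The center of a semigroup $X$ is $Z(X)=\{z\in X:\forall x\in X\ (xz=zx)\}$; $X$ is not assumed commutative, and $Z(X)$ may be empty (the empty semigroup is regarded as a semigroup). *)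

theory Defs
  imports "HOL-Analysis.Analysis"
begin

(* Semigroups and topological semigroups live on explicit carriers, so that the empty
   semigroup and subsemigroups such as the center are available.  The operation is a total
   function on the type, but only its values on the carrier matter. *)

definition semigroup_on :: "'a set \<Rightarrow> ('a \<Rightarrow> 'a \<Rightarrow> 'a) \<Rightarrow> bool" where
  "semigroup_on S m \<longleftrightarrow>
     (\<forall>x\<in>S. \<forall>y\<in>S. m x y \<in> S) \<and>
     (\<forall>x\<in>S. \<forall>y\<in>S. \<forall>z\<in>S. m (m x y) z = m x (m y z))"

definition semigroup_hom_on ::
    "'a set \<Rightarrow> ('a \<Rightarrow> 'a \<Rightarrow> 'a) \<Rightarrow> 'b set \<Rightarrow> ('b \<Rightarrow> 'b \<Rightarrow> 'b) \<Rightarrow> ('a \<Rightarrow> 'b) \<Rightarrow> bool" where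
  "semigroup_hom_on S m S' m' h \<longleftrightarrow>
     h \<in> S \<rightarrow> S' \<and> (\<forall>x\<in>S. \<forall>y\<in>S. h (m x y) = m' (h x) (h y))"

definition unipotent_on :: "'a set \<Rightarrow> ('a \<Rightarrow> 'a \<Rightarrow> 'a) \<Rightarrow> bool" where
  "unipotent_on S m \<longleftrightarrow> (\<exists>!e. e \<in> S \<and> m e e = e)"

definition center_on :: "'a set \<Rightarrow> ('a \<Rightarrow> 'a \<Rightarrow> 'a) \<Rightarrow> 'a set" where
  "center_on S m = {z \<in> S. \<forall>x\<in>S. m x z = m z x}"

definition topological_semigroup :: "'a topology \<Rightarrow> ('a \<Rightarrow> 'a \<Rightarrow> 'a) \<Rightarrow> bool" where
  "topological_semigroup T m \<longleftrightarrow>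
     semigroup_on (topspace T) m \<and>
     continuous_map (prod_topology T T) T (\<lambda>(x, y). m x y)"

definition zero_dimensional_space :: "'a topology \<Rightarrow> bool" where
  "zero_dimensional_space T \<longleftrightarrow>
     (\<exists>B. (\<forall>U\<in>B. openin T U \<and> closedin T U) \<and>
          (\<forall>W x. openin T W \<and> x \<in> W \<longrightarrow> (\<exists>U\<in>B. x \<in> U \<and> U \<subseteq> W)))"

(* A class of topological semigroups is a set of pairs (topology, operation) over a type 'b
   that serves as the universe of underlying points.  When testing absolute closedness of X it
   suffices that 'b holds a copy of X: if X is infinite and h[X] is not closed in a Hausdorff
   zero-dimensional Y (over any type), pick y in the closure of h[X] outside h[X]; the
   subsemigroup of Y generated by h[X] and y has at most card X points, is again Hausdorff
   zero-dimensional, and h[X] is not closed in it, so after renaming its points it lives over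
   'b.  If X is finite, h[X] is closed in every T1 space.  With a smaller 'b (e.g. unit), the
   notion would degenerate. *)

type_synonym 'b top_semigroup_class = "('b topology \<times> ('b \<Rightarrow> 'b \<Rightarrow> 'b)) set"

definition T1S :: "'b top_semigroup_class" where
  "T1S = {(T, m). topological_semigroup T m \<and> t1_space T}"

definition TzS :: "'b top_semigroup_class" where
  "TzS = {(T, m). topological_semigroup T m \<and> Hausdorff_space T \<and> zero_dimensional_space T}"

definition absolutely_closed_top ::
    "'b top_semigroup_class \<Rightarrow> 'a topology \<Rightarrow> ('a \<Rightarrow> 'a \<Rightarrow> 'a) \<Rightarrow> bool" where
  "absolutely_closed_top C T m \<longleftrightarrow>
     topological_semigroup T m \<and>
     (\<forall>(T', m')\<in>C. \<forall>h.
        continuous_map T T' h \<and> semigroup_hom_on (topspace T) m (topspace T') m' h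
          \<longrightarrow> closedin T' (h ` topspace T))"

definition absolutely_closed ::
    "'b top_semigroup_class \<Rightarrow> 'a set \<Rightarrow> ('a \<Rightarrow> 'a \<Rightarrow> 'a) \<Rightarrow> bool" where
  "absolutely_closed C S m \<longleftrightarrow> absolutely_closed_top C (discrete_topology S) m"

end

theory Submission
  imports Defs "HOL-Library.Ramsey" "HOL-Algebra.FiniteProduct" "HOL-Number_Theory.Cong"
begin

text \<open>Let \<open>i\<close> be the idempotent of \<open>X\<close> and \<open>Z\<close> its center.  Each way in which \<open>Z\<close> could be infinite is
  refuted by a homomorphism from \<open>X\<close> to a Hausdorff zero-dimensional topological semigroup with a
  non-closed image.  An element of infinite order is excluded by congruences modulo powers of 4 on
  its exponents; so \<open>Z\<close> is periodic, \<open>i\<close> is central, and the core \<open>iZ\<close> is a torsion abelian group.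
  If \<open>Z - iX\<close> were infinite, its boundedly nilpotent part would yield ideals
  \<open>I \<subseteq> D\<close> with \<open>DD \<subseteq> I\<close> and \<open>D - I\<close> infinite; then \<open>X/I\<close>, together with the free ultrafilters on
  the image of \<open>D\<close>, is a topological semigroup in which \<open>X/I\<close> is not closed.
  An infinite core of bounded exponent contains an infinite independent family of prime order,
  hence a decreasing sequence of subgroups with respect to which it is incomplete.  If the exponent
  is unbounded (e.g. for a quasicyclic group, which has no such sequence of subgroups), a sufficiently
  independent sequence in the core can be made to converge to a new element.\<close>

section \<open>Detecting non-closed images\<close>

unbundle cardinal_syntax

text \<open>Closedness is tested only by homomorphisms defined on all of \<open>X\<close>, so a
  homomorphism of the center is of no use until it is extended. Centrality permits the extension: a
  congruence on the core or on powers of \<open>z\<close> is carried to \<open>X\<close> by relating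
  two elements when central factors of the prescribed kind make them equal, and a central set
  generates its two-sided ideal by multiplication from one side. Unipotency identifies the
  idempotent powers of all central elements with the same \<open>i\<close>, and it makes the
  non-units of \<open>iX\<close> an ideal that can be collapsed to a zero. For the core, bounded
  exponent \<open>K\<close> rules out the new limit \<open>y\<close>: the terms converging to
  \<open>y\<close> have trivial power \<open>K\<close>, so that power of \<open>y\<close> could not
  be separated from the identity. In the unbounded case \<open>y\<close> gets no inverse. A
  neighbourhood of the power \<open>k\<close> of \<open>y\<close> then involves products of at most
  \<open>k\<close> terms, so only bounded exponents occur, and it suffices that the powers of
  \<open>a n\<close> up to exponent \<open>n\<close> avoid the words in earlier terms. A torsion
  abelian group of unbounded exponent always has such a sequence.\<close>

lemma semigroup_onD:
  assumes "semigroup_on S m"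
  shows "\<lbrakk>x \<in> S; y \<in> S\<rbrakk> \<Longrightarrow> m x y \<in> S"
    and "\<lbrakk>x \<in> S; y \<in> S; z \<in> S\<rbrakk> \<Longrightarrow> m (m x y) z = m x (m y z)"
  using assms by (auto simp: semigroup_on_def)

inductive_set sgen :: "('a \<Rightarrow> 'a \<Rightarrow> 'a) \<Rightarrow> 'a set \<Rightarrow> 'a set" for m A where
  base: "x \<in> A \<Longrightarrow> x \<in> sgen m A"
| mult: "\<lbrakk>x \<in> sgen m A; y \<in> sgen m A\<rbrakk> \<Longrightarrow> m x y \<in> sgen m A"

lemma sgen_subset:
  assumes "semigroup_on S m" "A \<subseteq> S" shows "sgen m A \<subseteq> S"
proof
  fix x assume "x \<in> sgen m A" then show "x \<in> S"
    by induction (use assms in \<open>auto simp: semigroup_on_def\<close>)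
qed

text \<open>The generated set is exhausted by countably many levels \<open>F n\<close>, and an
  infinite \<open>X\<close> absorbs both squares and countable unions.\<close>

lemma card_of_sgen:
  fixes A :: "'a set" and X :: "'c set"
  assumes "infinite X" "|A| \<le>o |X|"
  shows "|sgen m A| \<le>o |X|"
proof -
  define F where "F = rec_nat A (\<lambda>_ B. B \<union> (\<lambda>(x, y). m x y) ` (B \<times> B))"
  have F_0: "F 0 = A" and F_Suc: "\<And>n. F (Suc n) = F n \<union> (\<lambda>(x, y). m x y) ` (F n \<times> F n)"
    by (simp_all add: F_def)
  have mono: "F i \<subseteq> F j" if "i \<le> j" for i j
    using lift_Suc_mono_le[of F i j] F_Suc that by auto
  have "|F n| \<le>o |X|" for n
  proof (induction n)
    case (Suc n)
    have "|F n \<times> F n| \<le>o |X|"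
      using Suc assms(1) by (intro card_of_Times_ordLeq_infinite_Field) (auto simp: Field_card_of card_of_card_order_on)
    then have "|(\<lambda>(x, y). m x y) ` (F n \<times> F n)| \<le>o |X|"
      using card_of_image ordLeq_transitive by blast
    with Suc show ?case
      unfolding F_Suc using assms(1)
      by (intro card_of_Un_ordLeq_infinite_Field) (auto simp: Field_card_of card_of_card_order_on)
  qed (simp add: F_0 assms)
  moreover have "|UNIV :: nat set| \<le>o |X|"
    using assms(1) infinite_iff_card_of_nat by blast
  ultimately have "|\<Union>n. F n| \<le>o |X|"
    using assms(1) by (intro card_of_UNION_ordLeq_infinite) auto
  moreover have "sgen m A \<subseteq> (\<Union>n. F n)"
  proof
    fix x assume "x \<in> sgen m A" then show "x \<in> (\<Union>n. F n)"
    proof induction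
      case (base x) then show ?case using F_0 by auto
    next
      case (mult x y)
      then obtain i j where "x \<in> F i" "y \<in> F j" by auto
      then have "x \<in> F (max i j)" "y \<in> F (max i j)"
        using mono[of i "max i j"] mono[of j "max i j"] by auto
      then have "m x y \<in> F (Suc (max i j))" by (auto simp: F_Suc)
      then show ?case by blast
    qed
  qed
  ultimately show ?thesis
    using card_of_mono1 ordLeq_transitive by blast
qed

text \<open>Restricting to the subsemigroup generated by \<open>h ` X\<close> and one further point brings a
  target over an arbitrary type down to the cardinality of \<open>X\<close>, hence into the universe \<open>'b\<close>.\<close>

lemma absolutely_closed_closedin_image:
  fixes T :: "'c topology" and X :: "'a set" and C :: "'b top_semigroup_class" and e :: "'a \<Rightarrow> 'b"
  assumes C: "TzS \<subseteq> C" and cl: "absolutely_closed C X m" and e: "inj_on e X" and inf: "infinite X"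
    and T: "(T, m') \<in> TzS"
    and h: "semigroup_hom_on X m (topspace T) m' h"
  shows "closedin T (h ` X)"
proof (rule ccontr)
  assume ncl: "\<not> closedin T (h ` X)"
  have sgT: "semigroup_on (topspace T) m'"
    and contT: "continuous_map (prod_topology T T) T (\<lambda>(x, y). m' x y)"
    and HT: "Hausdorff_space T" and zT: "zero_dimensional_space T"
    using T by (auto simp: TzS_def topological_semigroup_def)
  have hX: "h ` X \<subseteq> topspace T" using h by (auto simp: semigroup_hom_on_def)
  obtain y where y: "y \<in> T closure_of (h ` X)" "y \<notin> h ` X"
    using ncl hX closure_of_subset_eq by blast
  have yT: "y \<in> topspace T" using y by (meson closure_of_subset_topspace in_mono)
  define S where "S = sgen m' (insert y (h ` X))"
  have ST: "S \<subseteq> topspace T" unfolding S_def using sgT hX yT by (intro sgen_subset) auto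
  have hS: "h ` X \<subseteq> S" and yS: "y \<in> S" unfolding S_def by (auto intro: sgen.base)
  have mS: "m' a b \<in> S" if "a \<in> S" "b \<in> S" for a b
    using that unfolding S_def by (rule sgen.mult)
  have "|{y} \<union> h ` X| \<le>o |X|"
    using inf card_of_image[of h X] by (intro card_of_Un_ordLeq_infinite_Field)
      (auto simp: Field_card_of card_of_card_order_on intro: card_of_singl_ordLeq)
  then have "|S| \<le>o |X|" unfolding S_def using inf by (intro card_of_sgen) auto
  also have "|X| \<le>o |UNIV :: 'b set|" using e card_of_ordLeq[of X "UNIV :: 'b set"] by auto
  finally obtain f :: "'c \<Rightarrow> 'b" where f: "inj_on f S"
    by (metis card_of_ordLeq)
  define g where "g = inv_into S f"
  have gf: "\<And>s. s \<in> S \<Longrightarrow> g (f s) = s" unfolding g_def using f by simp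
  \<comment> \<open>Transport of structure: this is the subspace topology of \<open>S\<close>,
    copied along \<open>f\<close> into the universe of \<open>C\<close>.\<close>
  define T' where "T' = pullback_topology (f ` S) g T"
  define m'' where "m'' = (\<lambda>a b. f (m' (g a) (g b)))"
  have topT': "topspace T' = f ` S"
    using ST gf unfolding T'_def topspace_pullback_topology by auto
  have openT': "openin T' W \<longleftrightarrow> (\<exists>U. openin T U \<and> W = f ` (U \<inter> S))" for W
  proof -
    have "g -` U \<inter> f ` S = f ` (U \<inter> S)" for U using gf by auto
    then show ?thesis unfolding T'_def openin_pullback_topology by simp
  qed
  have closedT': "closedin T' (f ` (U \<inter> S))" if "closedin T U" for U
  proof -
    have "f ` S - f ` (U \<inter> S) = f ` ((topspace T - U) \<inter> S)"
      using ST f by (auto simp: inj_on_def)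
    moreover have "openin T (topspace T - U)" using that by auto
    ultimately show ?thesis unfolding closedin_def topT' openT' by auto
  qed
  have contg: "continuous_map T' T g"
  proof -
    have "{x \<in> topspace T'. g x \<in> U} = f ` (U \<inter> S)" for U using gf by (auto simp: topT')
    then have "openin T' {x \<in> topspace T'. g x \<in> U}" if "openin T U" for U
      using that openT' by metis
    moreover have "g \<in> topspace T' \<rightarrow> topspace T" using gf ST topT' by auto
    ultimately show ?thesis unfolding continuous_map_def by blast
  qed
  have contf: "continuous_map (subtopology T S) T' f"
  proof -
    have "{x \<in> topspace (subtopology T S). f x \<in> f ` (U \<inter> S)} = S \<inter> U" for U
      using ST f by (auto simp: inj_on_def)
    then have "openin (subtopology T S) {x \<in> topspace (subtopology T S). f x \<in> W}"
      if "openin T' W" for W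
      using that unfolding openT' by (metis openin_subtopology_Int2)
    moreover have "f \<in> topspace (subtopology T S) \<rightarrow> topspace T'" using topT' by auto
    ultimately show ?thesis unfolding continuous_map_def by blast
  qed
  have "topological_semigroup T' m''"
  proof -
    have "semigroup_on (f ` S) m''"
      unfolding semigroup_on_def m''_def using mS gf semigroup_onD(2)[OF sgT] ST by (auto simp: subset_iff)
    moreover have "continuous_map (prod_topology T' T') T' (f \<circ> (\<lambda>p. m' (g (fst p)) (g (snd p))))"
    proof (rule continuous_map_compose[OF _ contf])
      have "continuous_map (prod_topology T' T') (prod_topology T T) (\<lambda>p. (g (fst p), g (snd p)))"
        using contg by (intro continuous_map_pairedI)
          (auto intro: continuous_map_compose[OF continuous_map_fst, unfolded o_def]
            continuous_map_compose[OF continuous_map_snd, unfolded o_def])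
      from continuous_map_compose[OF this contT]
      have "continuous_map (prod_topology T' T') T (\<lambda>p. m' (g (fst p)) (g (snd p)))"
        by (simp add: o_def)
      then show "continuous_map (prod_topology T' T') (subtopology T S) (\<lambda>p. m' (g (fst p)) (g (snd p)))"
        using mS gf by (auto simp: continuous_map_in_subtopology topT')
    qed
    ultimately show ?thesis
      by (simp add: topological_semigroup_def topT' m''_def o_def case_prod_unfold)
  qed
  moreover have "Hausdorff_space T'"
    using HT contg by (rule Hausdorff_space_injective_preimage)
      (use gf topT' in \<open>auto simp: inj_on_def\<close>)
  moreover have "zero_dimensional_space T'"
  proof -
    obtain B where B: "\<And>U. U \<in> B \<Longrightarrow> openin T U \<and> closedin T U"
      "\<And>W x. openin T W \<Longrightarrow> x \<in> W \<Longrightarrow> \<exists>U\<in>B. x \<in> U \<and> U \<subseteq> W"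
      using zT unfolding zero_dimensional_space_def by metis
    show ?thesis unfolding zero_dimensional_space_def
    proof (intro exI[of _ "(\<lambda>U. f ` (U \<inter> S)) ` B"] conjI ballI allI impI)
      fix W x assume "openin T' W \<and> x \<in> W"
      then obtain U s where U: "openin T U" "W = f ` (U \<inter> S)" "s \<in> U" "s \<in> S" "x = f s"
        using openT' by blast
      then obtain V where "V \<in> B" "s \<in> V" "V \<subseteq> U" using B by blast
      then show "\<exists>U\<in>(\<lambda>U. f ` (U \<inter> S)) ` B. x \<in> U \<and> U \<subseteq> W" using U by blast
    qed (use B openT' closedT' in blast)+
  qed
  ultimately have "(T', m'') \<in> C" using C by (auto simp: TzS_def)
  moreover have "semigroup_hom_on X m (f ` S) m'' (f \<circ> h)"
    using h hS gf unfolding semigroup_hom_on_def m''_def by (auto simp: image_subset_iff)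
  moreover have "continuous_map (discrete_topology X) T' (f \<circ> h)"
    using hS topT' by auto
  ultimately have "closedin T' ((f \<circ> h) ` X)"
    using cl topT' unfolding absolutely_closed_def absolutely_closed_top_def by fastforce
  then have "openin T' (f ` S - f ` h ` X)" by (simp add: closedin_def topT' image_comp)
  then obtain U where U: "openin T U" "f ` S - f ` h ` X = f ` (U \<inter> S)" using openT' by auto
  have "f y \<in> f ` S - f ` h ` X" using y yS hS f by (auto simp: inj_on_def)
  then have "y \<in> U" using U(2) yS f by (auto simp: inj_on_def)
  then obtain x where "x \<in> X" "h x \<in> U"
    using y U(1) by (auto simp: in_closure_of)
  then show False using U(2) hS by blast
qed

unbundle no cardinal_syntax

text \<open>The members of \<open>V x\<close> form a base of clopen neighbourhoods at \<open>x\<close>.\<close>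

lemma absolutely_closed_clopen_base:
  fixes S :: "'c set" and X :: "'a set" and C :: "'b top_semigroup_class" and e :: "'a \<Rightarrow> 'b"
    and V :: "'c \<Rightarrow> 'c set set"
  assumes C: "TzS \<subseteq> C" and cl: "absolutely_closed C X m" and e: "inj_on e X" and inf: "infinite X"
    and sg: "semigroup_on S m'"
    and h: "semigroup_hom_on X m S m' h"
    and ne: "\<And>x. x \<in> S \<Longrightarrow> V x \<noteq> {}"
    and sub: "\<And>x U. \<lbrakk>x \<in> S; U \<in> V x\<rbrakk> \<Longrightarrow> x \<in> U \<and> U \<subseteq> S"
    and int: "\<And>x U W. \<lbrakk>x \<in> S; U \<in> V x; W \<in> V x\<rbrakk> \<Longrightarrow> \<exists>Q\<in>V x. Q \<subseteq> U \<inter> W"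
    and op: "\<And>x U y. \<lbrakk>x \<in> S; U \<in> V x; y \<in> U\<rbrakk> \<Longrightarrow> \<exists>W\<in>V y. W \<subseteq> U"
    and clop: "\<And>x U y. \<lbrakk>x \<in> S; U \<in> V x; y \<in> S; y \<notin> U\<rbrakk> \<Longrightarrow> \<exists>W\<in>V y. W \<inter> U = {}"
    and sep: "\<And>x y. \<lbrakk>x \<in> S; y \<in> S; x \<noteq> y\<rbrakk> \<Longrightarrow> \<exists>U\<in>V x. y \<notin> U"
    and cont: "\<And>x y U. \<lbrakk>x \<in> S; y \<in> S; U \<in> V (m' x y)\<rbrakk> \<Longrightarrow>
      \<exists>P\<in>V x. \<exists>Q\<in>V y. \<forall>a\<in>P. \<forall>b\<in>Q. m' a b \<in> U"
    and y: "y \<in> S" and approx: "\<And>U. U \<in> V y \<Longrightarrow> U \<inter> h ` X \<noteq> {}"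
  shows "y \<in> h ` X"
proof -
  define O' where "O' = (\<lambda>W. W \<subseteq> S \<and> (\<forall>x\<in>W. \<exists>U\<in>V x. U \<subseteq> W))"
  define T where "T = topology O'"
  have "istopology O'"
    unfolding istopology_def
  proof (intro conjI allI impI)
    fix A B assume A: "O' A" and B: "O' B"
    have "\<exists>Q\<in>V x. Q \<subseteq> A \<inter> B" if x: "x \<in> A \<inter> B" for x
    proof -
      obtain U where U: "U \<in> V x" "U \<subseteq> A" using A x unfolding O'_def by blast
      obtain W where W: "W \<in> V x" "W \<subseteq> B" using B x unfolding O'_def by blast
      have "x \<in> S" using A x unfolding O'_def by blast
      then obtain Q where "Q \<in> V x" "Q \<subseteq> U \<inter> W" using int U(1) W(1) by blast
      then show ?thesis using U W by (intro bexI[of _ Q]) auto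
    qed
    moreover have "A \<inter> B \<subseteq> S" using A unfolding O'_def by blast
    ultimately show "O' (A \<inter> B)" unfolding O'_def by blast
  next
    fix \<K> assume \<K>: "\<forall>K\<in>\<K>. O' K"
    have "\<exists>U\<in>V x. U \<subseteq> \<Union>\<K>" if x: "x \<in> \<Union>\<K>" for x
    proof -
      obtain K where K: "K \<in> \<K>" "x \<in> K" using x by blast
      then obtain U where "U \<in> V x" "U \<subseteq> K" using \<K> unfolding O'_def by blast
      then show ?thesis using K by (intro bexI[of _ U]) auto
    qed
    moreover have "\<Union>\<K> \<subseteq> S" using \<K> unfolding O'_def by blast
    ultimately show "O' (\<Union>\<K>)" unfolding O'_def by blast
  qed
  then have openT: "openin T W \<longleftrightarrow> O' W" for W unfolding T_def by simp
  have "O' S"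
    unfolding O'_def
  proof (intro conjI ballI)
    fix x assume "x \<in> S"
    then obtain U where "U \<in> V x" using ne by blast
    then show "\<exists>U\<in>V x. U \<subseteq> S" using sub[OF \<open>x \<in> S\<close>] by blast
  qed simp
  have topT: "topspace T = S"
  proof
    show "topspace T \<subseteq> S" using openT[of "topspace T"] by (simp add: O'_def)
    show "S \<subseteq> topspace T" using \<open>O' S\<close> openin_subset[of T S] by (simp add: openT)
  qed
  have Vop: "openin T U" if "x \<in> S" "U \<in> V x" for x U
    unfolding openT O'_def using sub[OF that] op[OF that] by simp
  have Vcl: "closedin T U" if xU: "x \<in> S" "U \<in> V x" for x U
  proof -
    have "O' (S - U)" unfolding O'_def
    proof (intro conjI ballI)
      fix y assume "y \<in> S - U"
      then obtain W where "W \<in> V y" "W \<inter> U = {}" using clop[OF xU, of y] by blast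
      then show "\<exists>W\<in>V y. W \<subseteq> S - U" using sub[of y W] \<open>y \<in> S - U\<close> by blast
    qed auto
    then show ?thesis unfolding closedin_def topT openT using sub[OF xU] by blast
  qed
  have "zero_dimensional_space T"
    unfolding zero_dimensional_space_def
  proof (intro exI[of _ "\<Union>x\<in>S. V x"] conjI ballI allI impI)
    fix W x assume "openin T W \<and> x \<in> W"
    then obtain U where "x \<in> S" "U \<in> V x" "U \<subseteq> W" unfolding openT O'_def by (meson subsetD)
    then show "\<exists>U\<in>\<Union> (V ` S). x \<in> U \<and> U \<subseteq> W" using sub[of x U] by (meson UN_I)
  qed (use Vop Vcl in auto)
  moreover have "Hausdorff_space T"
    unfolding Hausdorff_space_def topT
  proof (intro allI impI)
    fix x y assume *: "x \<in> S \<and> y \<in> S \<and> x \<noteq> y"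
    then obtain U where U: "U \<in> V x" "y \<notin> U" using sep by blast
    then obtain W where "W \<in> V y" "W \<inter> U = {}" using clop * by blast
    then show "\<exists>U V. openin T U \<and> openin T V \<and> x \<in> U \<and> y \<in> V \<and> disjnt U V"
      using U * Vop[of x U] Vop[of y W] sub[of x U] sub[of y W]
      by (intro exI[of _ U] exI[of _ W]) (simp add: disjnt_def Int_commute)
  qed
  moreover have "continuous_map (prod_topology T T) T (\<lambda>(x, y). m' x y)"
    unfolding continuous_map_def topspace_prod_topology topT
  proof (intro conjI allI impI)
    fix W assume W: "openin T W"
    show "openin (prod_topology T T) {x \<in> S \<times> S. (case x of (x, y) \<Rightarrow> m' x y) \<in> W}"
      unfolding openin_prod_topology_alt
    proof (intro allI impI)
      fix a b assume "(a, b) \<in> {x \<in> S \<times> S. (case x of (x, y) \<Rightarrow> m' x y) \<in> W}"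
      then have ab: "a \<in> S" "b \<in> S" "m' a b \<in> W" by auto
      then obtain U where U: "U \<in> V (m' a b)" "U \<subseteq> W" using W unfolding openT O'_def by meson
      obtain P Q where "P \<in> V a" "Q \<in> V b" "\<forall>a\<in>P. \<forall>b\<in>Q. m' a b \<in> W"
        using cont[OF ab(1,2) U(1)] U(2) by (meson subsetD)
      then show "\<exists>U V. openin T U \<and> openin T V \<and> a \<in> U \<and> b \<in> V \<and>
          U \<times> V \<subseteq> {x \<in> S \<times> S. (case x of (x, y) \<Rightarrow> m' x y) \<in> W}"
        using ab sub[of a P] sub[of b Q] Vop[of a P] Vop[of b Q]
        by (intro exI[of _ P] exI[of _ Q]) auto
    qed
  qed (use sg in \<open>auto simp: semigroup_on_def\<close>)
  ultimately have "(T, m') \<in> TzS"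
    using sg by (simp add: TzS_def topological_semigroup_def topT)
  then have "closedin T (h ` X)"
    using absolutely_closed_closedin_image[OF C cl e inf] h topT by metis
  then have "O' (S - h ` X)" by (simp add: closedin_def topT openT)
  then have "y \<notin> h ` X \<Longrightarrow> \<exists>U\<in>V y. U \<subseteq> S - h ` X" using y by (simp add: O'_def)
  then show ?thesis using approx by blast
qed

locale absolutely_closed_semigroup =
  fixes X :: "'a set" and m :: "'a \<Rightarrow> 'a \<Rightarrow> 'a"
    and C :: "'b top_semigroup_class" and e :: "'a \<Rightarrow> 'b"
  assumes TzS_subset: "TzS \<subseteq> C"
    and closed: "absolutely_closed C X m"
    and semigroup: "semigroup_on X m"
    and inj: "inj_on e X"
begin

lemmas mem = semigroup_onD(1)[OF semigroup]
lemmas assoc = semigroup_onD(2)[OF semigroup]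

lemmas clopen_base = absolutely_closed_clopen_base[OF TzS_subset closed inj]

end

section \<open>Ideals with zero multiplication\<close>

text \<open>An ultrafilter is encoded as its quantifier: \<open>q P\<close> says that
  \<open>P\<close> holds almost everywhere. Products of ultrafilters become nested quantifiers, and
  each axiom involves only finitely many values of \<open>q\<close>.\<close>

definition ultra_on :: "'a set \<Rightarrow> (('a \<Rightarrow> bool) \<Rightarrow> bool) \<Rightarrow> bool" where
  "ultra_on X q \<longleftrightarrow> q (\<lambda>b. b \<in> X) \<and> (\<forall>P. q (\<lambda>b. \<not> P b) = (\<not> q P)) \<and>
     (\<forall>P Q. q (\<lambda>b. P b \<and> Q b) = (q P \<and> q Q))"

lemma ultra_onD:
  assumes "ultra_on X q"
  shows "q (\<lambda>b. b \<in> X)" "q (\<lambda>b. \<not> P b) = (\<not> q P)" "q (\<lambda>b. P b \<and> Q b) = (q P \<and> q Q)"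
  using assms by (auto simp: ultra_on_def)

lemma ultra_on_False: "ultra_on X q \<Longrightarrow> \<not> q (\<lambda>_. False)"
  using ultra_onD(2,3)[of X q "\<lambda>_. False"] ultra_onD(3)[of X q "\<lambda>_. False" "\<lambda>_. True"] by auto

lemma ultra_on_mono:
  assumes "ultra_on X q" "q P" "\<And>b. \<lbrakk>b \<in> X; P b\<rbrakk> \<Longrightarrow> Q b"
  shows "q Q"
proof (rule ccontr)
  assume "\<not> q Q"
  then have "q (\<lambda>b. b \<in> X \<and> P b \<and> \<not> Q b)"
    using assms by (simp add: ultra_onD[OF assms(1)])
  moreover have "(\<lambda>b. b \<in> X \<and> P b \<and> \<not> Q b) = (\<lambda>_. False)" using assms(3) by auto
  ultimately show False using ultra_on_False[OF assms(1)] by simp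
qed

lemma ultra_on_ex: "\<lbrakk>ultra_on X q; q P\<rbrakk> \<Longrightarrow> \<exists>b\<in>X. P b"
  using ultra_on_mono[of X q P "\<lambda>_. False"] ultra_on_False[of X q] by blast

lemma ultra_on_cong:
  assumes "ultra_on X q" "\<And>b. b \<in> X \<Longrightarrow> P b = Q b"
  shows "q P = q Q"
  using ultra_on_mono[OF assms(1), of P Q] ultra_on_mono[OF assms(1), of Q P] assms(2) by blast

lemma ultra_on_principal: "b \<in> X \<Longrightarrow> ultra_on X (\<lambda>P. P b)"
  by (simp add: ultra_on_def)

lemma ultra_on_singleton:
  assumes "ultra_on X q" "q (\<lambda>c. c = b)"
  shows "q = (\<lambda>P. P b)"
proof
  fix P show "q P = P b"
  proof (cases "P b")
    case True
    then show ?thesis using ultra_on_mono[OF assms, of P] by auto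
  next
    case False
    then have "q (\<lambda>b. \<not> P b)" using ultra_on_mono[OF assms, of "\<lambda>b. \<not> P b"] by auto
    then show ?thesis using False ultra_onD(2)[OF assms(1), of P] by auto
  qed
qed

text \<open>A free ultrafilter is an accumulation point of the principal ones in the compact space
  \<open>2\<^sup>X\<close> of families of predicates.\<close>

lemma free_ultra_on_exists:
  assumes "infinite D" "D \<subseteq> X"
  shows "\<exists>q. ultra_on X q \<and> q (\<lambda>b. b \<in> D) \<and> (\<forall>b. \<not> q (\<lambda>c. c = b))"
proof -
  define T where "T = product_topology (\<lambda>_::'a \<Rightarrow> bool. discrete_topology (UNIV :: bool set)) UNIV"
  let ?pr = "\<lambda>(b::'a) P. P b :: bool"
  have topT: "topspace T = UNIV" by (simp add: T_def)
  have "compact_space T"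
    unfolding T_def by (simp add: compact_space_product_topology compact_space_discrete_topology)
  moreover have "inj ?pr"
  proof (rule injI)
    fix x y assume "?pr x = ?pr y"
    then have "?pr x (\<lambda>c. c = x) = ?pr y (\<lambda>c. c = x)" by (rule fun_cong)
    then show "x = y" by simp
  qed
  then have "infinite (?pr ` D)" using assms(1) finite_imageD inj_on_subset by blast
  ultimately obtain q where q: "q \<in> T derived_set_of (?pr ` D)"
    using compact_space_imp_Bolzano_Weierstrass[of T "?pr ` D"] topT by auto
  \<comment> \<open>A basic neighbourhood of \<open>q\<close> fixes finitely many coordinates, so
    relations among finitely many values of \<open>q\<close> can be checked at a point of
    \<open>D\<close>. Using the derived set instead of the closure provides
    \<open>?pr d \<noteq> q\<close>, which makes \<open>q\<close> free.\<close>
  have approx: "\<exists>d\<in>D. ?pr d \<noteq> q \<and> (\<forall>P\<in>F. q P = P d)" if "finite F" for F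
  proof -
    define W where "W = (\<Pi>\<^sub>E P\<in>UNIV. if P \<in> F then {q P} else UNIV)"
    have "openin T W"
      unfolding T_def W_def by (rule product_topology_basis) (auto intro: finite_subset[OF _ that])
    moreover have "q \<in> W" by (auto simp: W_def)
    ultimately obtain d where "d \<in> D" "?pr d \<noteq> q" "?pr d \<in> W"
      using q by (auto simp: in_derived_set_of)
    then show ?thesis by (intro bexI[of _ d]) (auto simp: W_def PiE_iff split: if_splits)
  qed
  have "ultra_on X q"
    unfolding ultra_on_def
  proof (intro conjI allI)
    show "q (\<lambda>b. b \<in> X)" using approx[of "{\<lambda>b. b \<in> X}"] assms(2) by auto
  next
    fix P show "q (\<lambda>b. \<not> P b) = (\<not> q P)" using approx[of "{P, \<lambda>b. \<not> P b}"] by auto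
  next
    fix P Q show "q (\<lambda>b. P b \<and> Q b) = (q P \<and> q Q)"
      using approx[of "{P, Q, \<lambda>b. P b \<and> Q b}"] by auto
  qed
  moreover have "q (\<lambda>b. b \<in> D)" using approx[of "{\<lambda>b. b \<in> D}"] by auto
  moreover have "\<not> q (\<lambda>c. c = b)" for b
  proof
    assume b: "q (\<lambda>c. c = b)"
    then have "?pr b \<noteq> q" using approx[of "{\<lambda>c. c = b}"] by auto
    then show False using ultra_on_singleton[OF \<open>ultra_on X q\<close> b] by auto
  qed
  ultimately show ?thesis by (intro exI[of _ q] conjI allI)
qed

context absolutely_closed_semigroup
begin

text \<open>The target semigroup consists of the ultrafilters on \<open>X\<close> that are principal or contain \<open>D\<close>,
  with the multiplication and the topology of the Stone-Cech compactification.  In general this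
  multiplication is continuous on one side only; joint continuity holds here because
  \<open>D\<close> is an ideal with zero multiplication.\<close>

lemma finite_null_ideal:
  assumes D: "D \<subseteq> X" and l: "\<And>x d. \<lbrakk>x \<in> X; d \<in> D\<rbrakk> \<Longrightarrow> m x d \<in> D"
    and r: "\<And>x d. \<lbrakk>x \<in> X; d \<in> D\<rbrakk> \<Longrightarrow> m d x \<in> D"
    and z: "z \<in> X" and null: "\<And>c d. \<lbrakk>c \<in> D; d \<in> D\<rbrakk> \<Longrightarrow> m c d = z"
  shows "finite D"
proof (rule ccontr)
  assume infD: "infinite D"
  then have infX: "infinite X" using D finite_subset by blast
  define S where "S = {q. ultra_on X q \<and> ((\<exists>b\<in>X. q = (\<lambda>P. P b)) \<or> q (\<lambda>b. b \<in> D))}"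
  \<comment> \<open>The product of ultrafilters: \<open>P\<close> holds at the product for almost
    all left factors and then almost all right factors.\<close>
  define mm where "mm = (\<lambda>(q :: ('a \<Rightarrow> bool) \<Rightarrow> bool) (r :: ('a \<Rightarrow> bool) \<Rightarrow> bool) P. q (\<lambda>b. r (\<lambda>c. P (m b c))))"
  define h where "h = (\<lambda>(b::'a) P. P b :: bool)"
  define V where "V = (\<lambda>q. {{q' \<in> S. q' P} |P. q P})"
  have uS: "ultra_on X q" if "q \<in> S" for q using that by (simp add: S_def)
  have ultra_mm: "ultra_on X (mm q r)" if q: "ultra_on X q" and r: "ultra_on X r" for q r
    unfolding ultra_on_def mm_def
  proof (intro conjI allI)
    show "q (\<lambda>b. r (\<lambda>c. m b c \<in> X))"
      by (intro ultra_on_mono[OF q ultra_onD(1)[OF q]] ultra_on_mono[OF r ultra_onD(1)[OF r]] mem)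
  qed (simp_all add: ultra_onD[OF q] ultra_onD[OF r])
  have null_mm: "mm q r P" if q: "ultra_on X q" "q (\<lambda>b. b \<in> D)" and r: "ultra_on X r" "r (\<lambda>b. b \<in> D)"
    and P: "P z" for q r P
    unfolding mm_def
    by (intro ultra_on_mono[OF q] ultra_on_mono[OF r]) (simp add: null P)
  have mm_S: "mm q r \<in> S" if q: "q \<in> S" and r: "r \<in> S" for q r
  proof -
    note uq = uS[OF q] and ur = uS[OF r]
    have "(\<exists>b\<in>X. mm q r = (\<lambda>P. P b)) \<or> mm q r (\<lambda>b. b \<in> D)"
    proof (cases "q (\<lambda>b. b \<in> D)")
      case qD: True
      show ?thesis
      proof (cases "r (\<lambda>b. b \<in> D)")
        case True
        then have "mm q r (\<lambda>c. c = z)" using null_mm qD uq ur by auto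
        then show ?thesis using ultra_on_singleton[OF ultra_mm[OF uq ur]] z by blast
      next
        case False
        then obtain c where "c \<in> X" "r = (\<lambda>P. P c)" using r by (auto simp: S_def)
        then show ?thesis using ultra_on_mono[OF uq qD] \<open>\<And>x d. \<lbrakk>x \<in> X; d \<in> D\<rbrakk> \<Longrightarrow> m d x \<in> D\<close>
          by (simp add: mm_def)
      qed
    next
      case False
      then obtain b where b: "b \<in> X" "q = (\<lambda>P. P b)" using q by (auto simp: S_def)
      show ?thesis
      proof (cases "r (\<lambda>b. b \<in> D)")
        case True
        then show ?thesis using ultra_on_mono[OF ur True] l b by (simp add: mm_def)
      next
        case False
        then obtain c where "c \<in> X" "r = (\<lambda>P. P c)" using r by (auto simp: S_def)
        then show ?thesis using b mem by (auto simp: mm_def)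
      qed
    qed
    then show ?thesis using ultra_mm[OF uq ur] by (simp add: S_def)
  qed
  have sgS: "semigroup_on S mm"
    unfolding semigroup_on_def
  proof (intro conjI ballI mm_S)
    fix q r s assume "q \<in> S" "r \<in> S" "s \<in> S"
    note u = uS[OF this(1)] uS[OF this(2)] uS[OF this(3)]
    show "mm (mm q r) s = mm q (mm r s)"
      unfolding mm_def
      by (intro ext ultra_on_cong[OF u(1)] ultra_on_cong[OF u(2)] ultra_on_cong[OF u(3)])
        (simp add: assoc)
  qed
  have hom: "semigroup_hom_on X m S mm h"
    by (auto simp: semigroup_hom_on_def h_def mm_def S_def ultra_on_principal)
  obtain q where q: "ultra_on X q" "q (\<lambda>b. b \<in> D)" "\<And>b. \<not> q (\<lambda>c. c = b)"
    using free_ultra_on_exists[OF infD D] by blast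
  have "q \<in> h ` X"
  proof (rule clopen_base[OF infX sgS hom, where V = V])
    show "q \<in> S" using q by (simp add: S_def)
  next
    fix q assume "q \<in> S" then show "V q \<noteq> {}" using ultra_onD(1) uS by (auto simp: V_def)
  next
    fix q U assume "q \<in> S" "U \<in> V q" then show "q \<in> U \<and> U \<subseteq> S" by (auto simp: V_def)
  next
    fix q U W assume q: "q \<in> S" and "U \<in> V q" "W \<in> V q"
    then obtain P Q where "U = {q' \<in> S. q' P}" "W = {q' \<in> S. q' Q}" "q P" "q Q" by (auto simp: V_def)
    moreover have "{q' \<in> S. q' (\<lambda>b. P b \<and> Q b)} = {q' \<in> S. q' P \<and> q' Q}"
      by (intro Collect_cong conj_cong refl ultra_onD(3)[where X = X] uS)
    moreover have "q (\<lambda>b. P b \<and> Q b)"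
      using \<open>q P\<close> \<open>q Q\<close> ultra_onD(3)[OF uS[OF q], of P Q] by blast
    then have "{q' \<in> S. q' (\<lambda>b. P b \<and> Q b)} \<in> V q" unfolding V_def by blast
    ultimately show "\<exists>R\<in>V q. R \<subseteq> U \<inter> W" by (intro bexI) auto
  next
    fix q U r assume "q \<in> S" "U \<in> V q" "r \<in> U"
    then show "\<exists>W\<in>V r. W \<subseteq> U" by (auto simp: V_def)
  next
    fix q U r assume "q \<in> S" "U \<in> V q" and r: "r \<in> S" "r \<notin> U"
    then obtain P where P: "U = {q' \<in> S. q' P}" "\<not> r P" by (auto simp: V_def)
    moreover have "{q' \<in> S. q' (\<lambda>b. \<not> P b)} = {q' \<in> S. \<not> q' P}"
      by (intro Collect_cong conj_cong refl ultra_onD(2)[where X = X] uS)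
    moreover have "r (\<lambda>b. \<not> P b)"
      using P(2) ultra_onD(2)[OF uS[OF r(1)], of P] by blast
    then have "{q' \<in> S. q' (\<lambda>b. \<not> P b)} \<in> V r" unfolding V_def by blast
    ultimately show "\<exists>W\<in>V r. W \<inter> U = {}" by (intro bexI) auto
  next
    fix q r assume q: "q \<in> S" "r \<in> S" "q \<noteq> r"
    then obtain P where "q P \<noteq> r P" by blast
    then have "\<exists>P. q P \<and> \<not> r P"
      using ultra_onD(2)[OF uS[OF q(1)], of P] ultra_onD(2)[OF uS[OF q(2)], of P] by metis
    then show "\<exists>U\<in>V q. r \<notin> U" by (auto simp: V_def)
  next
    fix q r U assume q: "q \<in> S" and r: "r \<in> S" and U: "U \<in> V (mm q r)"
    then obtain P where P: "U = {q' \<in> S. q' P}" "mm q r P" by (auto simp: V_def)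
    have pr: "\<exists>p\<in>X. q = (\<lambda>P. P p)" if "q \<in> S" "\<not> q (\<lambda>b. b \<in> D)" for q
      using that by (auto simp: S_def)
    have *: "\<exists>P'\<in>V q. \<exists>Q\<in>V r. \<forall>a\<in>P'. \<forall>b\<in>Q. mm a b \<in> U"
      if "q A" "r B" "\<And>a b. \<lbrakk>a \<in> S; b \<in> S; a A; b B\<rbrakk> \<Longrightarrow> mm a b P" for A B
    proof (intro bexI ballI)
      show "{q' \<in> S. q' A} \<in> V q" "{q' \<in> S. q' B} \<in> V r" using that(1,2) unfolding V_def by blast+
      fix a b assume "a \<in> {q' \<in> S. q' A}" "b \<in> {q' \<in> S. q' B}"
      then show "mm a b \<in> U" using mm_S[of a b] that(3)[of a b] by (simp add: P(1))
    qed
    \<comment> \<open>Two factors that contain \<open>D\<close> have the constant product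
      \<open>z\<close> on the neighbourhoods given by \<open>D\<close>. Otherwise one factor is
      principal, hence isolated, and continuity in the other one is enough.\<close>
    show "\<exists>P\<in>V q. \<exists>Q\<in>V r. \<forall>a\<in>P. \<forall>b\<in>Q. mm a b \<in> U"
    proof (cases "q (\<lambda>b. b \<in> D)")
      case qD: True
      show ?thesis
      proof (cases "r (\<lambda>b. b \<in> D)")
        case True
        have "P z"
        proof (rule ccontr)
          assume "\<not> P z"
          then have "mm q r (\<lambda>b. \<not> P b)" by (intro null_mm qD True uS q r)
          then show False using P(2) ultra_onD(2)[OF ultra_mm[OF uS[OF q] uS[OF r]], of P] by blast
        qed
        then show ?thesis by (intro *[OF qD True] null_mm uS)
      next
        case False
        then obtain c where c: "c \<in> X" "r = (\<lambda>P. P c)" using pr r by blast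
        show ?thesis
        proof (rule *[of "\<lambda>b. P (m b c)" "\<lambda>b. b = c"])
          fix q' r' assume "q' \<in> S" "r' \<in> S" "q' (\<lambda>b. P (m b c))" "r' (\<lambda>b. b = c)"
          then show "mm q' r' P" using ultra_on_singleton[OF uS[OF \<open>r' \<in> S\<close>]] by (auto simp: mm_def)
        qed (use P c in \<open>auto simp: mm_def\<close>)
      qed
    next
      case False
      then obtain c where c: "c \<in> X" "q = (\<lambda>P. P c)" using pr q by blast
      show ?thesis
      proof (rule *[of "\<lambda>b. b = c" "\<lambda>b. P (m c b)"])
        fix q' r' assume "q' \<in> S" "r' \<in> S" "q' (\<lambda>b. b = c)" "r' (\<lambda>b. P (m c b))"
        then show "mm q' r' P" using ultra_on_singleton[OF uS[OF \<open>q' \<in> S\<close>]] by (auto simp: mm_def)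
      qed (use P c in \<open>auto simp: mm_def\<close>)
    qed
  next
    fix U assume "U \<in> V q"
    then obtain P where P: "U = {q' \<in> S. q' P}" "q P" by (auto simp: V_def)
    obtain b where b: "b \<in> X" "P b" using ultra_on_ex[OF q(1) P(2)] by blast
    then have "h b \<in> S" using hom by (auto simp: semigroup_hom_on_def)
    then have "h b \<in> U" using P(1) b by (simp add: h_def)
    then show "U \<inter> h ` X \<noteq> {}" using b by blast
  qed
  then obtain b where "q = (\<lambda>P. P b)" by (auto simp: h_def)
  then show False using q(3)[of b] by simp
qed

section \<open>Ideals and Rees quotients\<close>

definition ideal_on :: "'a set \<Rightarrow> bool" where
  "ideal_on I \<longleftrightarrow> I \<subseteq> X \<and> I \<noteq> {} \<and> (\<forall>i\<in>I. \<forall>x\<in>X. m i x \<in> I \<and> m x i \<in> I)"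

lemma ideal_onD:
  assumes "ideal_on I" "i \<in> I"
  shows "i \<in> X" "x \<in> X \<Longrightarrow> m i x \<in> I" "x \<in> X \<Longrightarrow> m x i \<in> I"
  using assms by (auto simp: ideal_on_def)

text \<open>The Rees quotient by \<open>I\<close> is realized inside \<open>X\<close>, with a point \<open>z\<close> of \<open>I\<close> as its zero.\<close>

lemma finite_null_ideal_mod:
  assumes I: "ideal_on I" and D: "ideal_on D" and "I \<subseteq> D"
    and null: "\<And>c d. \<lbrakk>c \<in> D; d \<in> D\<rbrakk> \<Longrightarrow> m c d \<in> I"
  shows "finite (D - I)"
proof -
  obtain z where z: "z \<in> I" using I by (auto simp: ideal_on_def)
  define \<rho> where "\<rho> = (\<lambda>x. if x \<in> I then z else x)"
  define m' where "m' = (\<lambda>x y. \<rho> (m x y))"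
  have zX: "z \<in> X" using ideal_onD(1)[OF I z] .
  have \<rho>X: "\<rho> x \<in> X" if "x \<in> X" for x using that zX by (simp add: \<rho>_def)
  have \<rho>: "\<rho> (m (\<rho> x) y) = \<rho> (m x y)" "\<rho> (m x (\<rho> y)) = \<rho> (m x y)" if "x \<in> X" "y \<in> X" for x y
    using that ideal_onD[OF I] z by (auto simp: \<rho>_def)
  have sg': "semigroup_on (\<rho> ` X) m'"
    unfolding semigroup_on_def m'_def using mem \<rho>X by (auto simp: \<rho> assoc)
  have hom: "semigroup_hom_on X m (\<rho> ` X) m' \<rho>"
    unfolding semigroup_hom_on_def m'_def using \<rho>X by (simp add: \<rho>)
  \<comment> \<open>Absolute closedness passes to homomorphic images: composing with
    \<open>\<rho>\<close> turns a test homomorphism of the quotient into one of \<open>X\<close>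
    with the same image.\<close>
  have "absolutely_closed C (\<rho> ` X) m'"
    unfolding absolutely_closed_def absolutely_closed_top_def
  proof (intro conjI ballI)
    show "topological_semigroup (discrete_topology (\<rho> ` X)) m'"
      using sg' by (auto simp: topological_semigroup_def semigroup_on_def
          simp flip: prod_topology_discrete_topology)
  next
    fix p assume "p \<in> C"
    obtain T' n where p: "p = (T', n)" by fastforce
    have "\<forall>h. continuous_map (discrete_topology (\<rho> ` X)) T' h \<and>
        semigroup_hom_on (topspace (discrete_topology (\<rho> ` X))) m' (topspace T') n h \<longrightarrow>
        closedin T' (h ` topspace (discrete_topology (\<rho> ` X)))"
    proof (intro allI impI)
      fix h assume h: "continuous_map (discrete_topology (\<rho> ` X)) T' h \<and>
        semigroup_hom_on (topspace (discrete_topology (\<rho> ` X))) m' (topspace T') n h"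
      then have "semigroup_hom_on X m (topspace T') n (h \<circ> \<rho>)"
        using hom by (auto simp: semigroup_hom_on_def)
      moreover have "continuous_map (discrete_topology X) T' (h \<circ> \<rho>)" using h by auto
      ultimately show "closedin T' (h ` topspace (discrete_topology (\<rho> ` X)))"
        using closed \<open>p \<in> C\<close> p
        unfolding absolutely_closed_def absolutely_closed_top_def by (fastforce simp: image_comp)
    qed
    then show "case p of (T', n) \<Rightarrow> \<forall>h. continuous_map (discrete_topology (\<rho> ` X)) T' h \<and>
        semigroup_hom_on (topspace (discrete_topology (\<rho> ` X))) m' (topspace T') n h \<longrightarrow>
        closedin T' (h ` topspace (discrete_topology (\<rho> ` X)))"
      by (simp add: p)
  qed
  moreover have "inj_on e (\<rho> ` X)" using inj \<rho>X by (auto intro: inj_on_subset)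
  ultimately interpret Q: absolutely_closed_semigroup "\<rho> ` X" m' C e
    using sg' TzS_subset by unfold_locales
  have "finite (\<rho> ` D)"
  proof (rule Q.finite_null_ideal)
    show "z \<in> \<rho> ` X" using z zX by (auto simp: \<rho>_def intro!: image_eqI[of _ _ z])
    fix c d assume "c \<in> \<rho> ` D" "d \<in> \<rho> ` D"
    then show "m' c d = z"
      using null ideal_onD(1)[OF D] \<open>I \<subseteq> D\<close> z by (auto simp: m'_def \<rho>) (auto simp: \<rho>_def)
  qed (use ideal_onD[OF D] \<rho>X in \<open>auto simp: m'_def \<rho>\<close>)
  moreover have "D - I \<subseteq> \<rho> ` D" by (force simp: \<rho>_def)
  ultimately show ?thesis by (rule finite_subset[rotated])
qed

end

section \<open>Powers of central elements\<close>

context absolutely_closed_semigroup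
begin

text \<open>\<open>X\<close> is mapped to the product of its quotients by the congruences
  \<open>R n\<close>, each quotient being discrete. By coherence the classes of the
  \<open>s n\<close> form a limit of image points, and a closed image must contain it.\<close>

lemma coherent_sequence_realized:
  fixes R :: "nat \<Rightarrow> 'a \<Rightarrow> 'a \<Rightarrow> bool"
  assumes inf: "infinite X"
    and refl: "\<And>n x. x \<in> X \<Longrightarrow> R n x x"
    and sym: "\<And>n x y. \<lbrakk>x \<in> X; y \<in> X; R n x y\<rbrakk> \<Longrightarrow> R n y x"
    and trans: "\<And>n x y z. \<lbrakk>x \<in> X; y \<in> X; z \<in> X; R n x y; R n y z\<rbrakk> \<Longrightarrow> R n x z"
    and cong: "\<And>n x y x' y'. \<lbrakk>x \<in> X; y \<in> X; x' \<in> X; y' \<in> X; R n x x'; R n y y'\<rbrakk>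
      \<Longrightarrow> R n (m x y) (m x' y')"
    and s: "\<And>n. s n \<in> X" and coh: "\<And>n k. n \<le> k \<Longrightarrow> R n (s k) (s n)"
  shows "\<exists>y\<in>X. \<forall>n. R n y (s n)"
proof -
  \<comment> \<open>Chosen representatives stand for the classes, so that points of the product are
    functions into \<open>X\<close>.\<close>
  define rep where "rep = (\<lambda>n x. SOME y. y \<in> X \<and> R n x y)"
  have rep: "rep n x \<in> X \<and> R n x (rep n x)" if "x \<in> X" for n x
    unfolding rep_def by (rule someI[of _ x]) (use that refl in blast)
  have rep_eq: "rep n x = rep n y" if "x \<in> X" "y \<in> X" "R n x y" for n x y
  proof -
    have "(\<lambda>z. z \<in> X \<and> R n x z) = (\<lambda>z. z \<in> X \<and> R n y z)"
      using that trans sym by blast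
    then show ?thesis by (simp add: rep_def)
  qed
  have rep_iff: "rep n x = rep n y \<longleftrightarrow> R n x y" if "x \<in> X" "y \<in> X" for n x y
    using that rep_eq rep sym trans by metis
  have rep_m: "rep n (m (rep n x) y) = rep n (m x y)" "rep n (m x (rep n y)) = rep n (m x y)"
    if "x \<in> X" "y \<in> X" for n x y
    by (intro rep_eq cong refl sym[of x] sym[of y] mem that conjunct1[OF rep] conjunct2[OF rep])+
  define S where "S = {f. \<forall>n::nat. f n \<in> rep n ` X}"
  define mm where "mm = (\<lambda>f g (n::nat). rep n (m (f n) (g n)))"
  define h where "h = (\<lambda>x n. rep n x)"
  define V where "V = (\<lambda>f. {{g \<in> S. \<forall>n\<le>k. g n = f n} |k::nat. True})"
  have SX: "f n \<in> X" if f: "f \<in> S" for f n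
  proof -
    obtain x where "x \<in> X" "f n = rep n x" using f unfolding S_def by blast
    then show ?thesis using rep by simp
  qed
  have sgS: "semigroup_on S mm"
    unfolding semigroup_on_def
  proof (intro conjI ballI)
    fix f g k assume "f \<in> S" "g \<in> S" "k \<in> S"
    then show "mm (mm f g) k = mm f (mm g k)"
      by (simp add: mm_def rep_m SX mem assoc)
  next
    fix f g assume "f \<in> S" "g \<in> S"
    then show "mm f g \<in> S" using SX mem by (auto simp: mm_def S_def)
  qed
  have hom: "semigroup_hom_on X m S mm h"
    using rep by (auto simp: semigroup_hom_on_def h_def S_def mm_def rep_m)
  have "(\<lambda>n. rep n (s n)) \<in> h ` X"
  proof (rule clopen_base[OF inf sgS hom, where V = V])
    show "(\<lambda>n. rep n (s n)) \<in> S" using s by (simp add: S_def)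
  next
    fix f show "V f \<noteq> {}" by (auto simp: V_def)
  next
    fix f U assume "f \<in> S" "U \<in> V f" then show "f \<in> U \<and> U \<subseteq> S" by (auto simp: V_def)
  next
    fix f U W assume "f \<in> S" "U \<in> V f" "W \<in> V f"
    then obtain k l where "U = {g \<in> S. \<forall>n\<le>k. g n = f n}" "W = {g \<in> S. \<forall>n\<le>l. g n = f n}"
      by (auto simp: V_def)
    then show "\<exists>Q\<in>V f. Q \<subseteq> U \<inter> W"
      by (intro bexI[of _ "{g \<in> S. \<forall>n\<le>max k l. g n = f n}"]) (auto simp: V_def)
  next
    fix f U g assume "f \<in> S" "U \<in> V f" "g \<in> U"
    then obtain k where "U = {g \<in> S. \<forall>n\<le>k. g n = f n}" "\<forall>n\<le>k. g n = f n" by (auto simp: V_def)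
    then have "U = {h \<in> S. \<forall>n\<le>k. h n = g n}" by simp
    then have "U \<in> V g" unfolding V_def by blast
    then show "\<exists>W\<in>V g. W \<subseteq> U" by blast
  next
    fix f U g assume "f \<in> S" "U \<in> V f" "g \<in> S" "g \<notin> U"
    then obtain k n where "U = {g \<in> S. \<forall>n\<le>k. g n = f n}" "n \<le> k" "g n \<noteq> f n" by (auto simp: V_def)
    then show "\<exists>W\<in>V g. W \<inter> U = {}"
      by (intro bexI[of _ "{h \<in> S. \<forall>n\<le>k. h n = g n}"]) (auto simp: V_def)
  next
    fix f g assume "f \<in> S" "g \<in> S" "f \<noteq> g"
    then obtain n where "f n \<noteq> g n" by blast
    then show "\<exists>U\<in>V f. g \<notin> U"
      by (intro bexI[of _ "{h \<in> S. \<forall>i\<le>n. h i = f i}"]) (auto simp: V_def)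
  next
    fix f g U assume fg: "f \<in> S" "g \<in> S" and "U \<in> V (mm f g)"
    then obtain k where k: "U = {h \<in> S. \<forall>n\<le>k. h n = mm f g n}" by (auto simp: V_def)
    show "\<exists>P\<in>V f. \<exists>Q\<in>V g. \<forall>a\<in>P. \<forall>b\<in>Q. mm a b \<in> U"
    proof (intro bexI ballI)
      fix a b assume "a \<in> {h \<in> S. \<forall>n\<le>k. h n = f n}" "b \<in> {h \<in> S. \<forall>n\<le>k. h n = g n}"
      then show "mm a b \<in> U" unfolding k using semigroup_onD(1)[OF sgS] by (auto simp: mm_def)
    qed (auto simp: V_def)
  next
    fix U assume "U \<in> V (\<lambda>n. rep n (s n))"
    then obtain k where k: "U = {h \<in> S. \<forall>n\<le>k. h n = rep n (s n)}" by (auto simp: V_def)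
    \<comment> \<open>By coherence \<open>s k\<close> has the prescribed class in every coordinate
      up to \<open>k\<close>.\<close>
    have "h (s k) \<in> U" using hom s coh unfolding k
      by (auto simp: h_def semigroup_hom_on_def intro!: rep_eq)
    then show "U \<inter> h ` X \<noteq> {}" using s by blast
  qed
  then obtain y where y: "y \<in> X" "(\<lambda>n. rep n (s n)) = h y" by blast
  then have "rep n (s n) = rep n y" for n by (metis h_def)
  then show ?thesis using y(1) rep_iff s by metis
qed

section \<open>The center and the ideals generated by central sets\<close>

abbreviation "Z \<equiv> center_on X m"

lemma center_in: "z \<in> Z \<Longrightarrow> z \<in> X"
  by (simp add: center_on_def)

lemma center_commute: "\<lbrakk>z \<in> Z; x \<in> X\<rbrakk> \<Longrightarrow> m x z = m z x"
  by (simp add: center_on_def)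

lemma center_left_commute: "\<lbrakk>z \<in> Z; x \<in> X; y \<in> X\<rbrakk> \<Longrightarrow> m x (m z y) = m z (m x y)"
  by (metis assoc center_commute center_in)

lemma center_mem:
  assumes a: "a \<in> Z" and b: "b \<in> Z"
  shows "m a b \<in> Z"
proof -
  note X = center_in[OF a] center_in[OF b]
  have "m x (m a b) = m (m a b) x" if x: "x \<in> X" for x
    using center_left_commute[OF a x X(2)] center_commute[OF b x] assoc[OF X x] by simp
  then show ?thesis using mem[OF X] by (simp add: center_on_def)
qed

lemma semigroup_center: "semigroup_on Z m"
  using center_mem center_in assoc by (auto simp: semigroup_on_def)

text \<open>For a nonempty central \<open>A\<close> this is the two-sided ideal generated by
  \<open>A\<close>; the set \<open>A\<close> is added because \<open>X\<close> may lack an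
  identity.\<close>

definition gen :: "'a set \<Rightarrow> 'a set" where
  "gen A = A \<union> {m a x |a x. a \<in> A \<and> x \<in> X}"

lemma ideal_Un_gen:
  assumes I: "ideal_on I" and A: "A \<subseteq> Z"
  shows "ideal_on (I \<union> gen A)"
proof -
  have "m i x \<in> gen A \<and> m x i \<in> gen A" if i: "i \<in> gen A" and x: "x \<in> X" for i x
  proof (cases "i \<in> A")
    case True
    then show ?thesis using x A center_commute[of i x] by (auto simp: gen_def subset_iff)
  next
    case False
    then obtain a y where a: "a \<in> A" "y \<in> X" "i = m a y" using i by (auto simp: gen_def)
    then have "a \<in> X" "a \<in> Z" using A center_in by blast+
    then have "m i x = m a (m y x)" "m x i = m a (m x y)"
      using a x by (auto simp: assoc center_left_commute)
    then show ?thesis using a x mem by (auto simp: gen_def)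
  qed
  moreover have "gen A \<subseteq> X" using A center_in mem by (auto simp: gen_def)
  ultimately show ?thesis using I unfolding ideal_on_def by blast
qed

text \<open>By Ramsey's theorem, pass to an infinite subset \<open>A\<close> whose pairwise products all lie in \<open>I\<close>
  or all avoid \<open>I\<close>.  In either case \<open>A\<close> is disjoint from the ideal \<open>J\<close> generated by \<open>I\<close> and \<open>AA\<close>:
  if \<open>t = abx\<close> then \<open>ta\<close> and \<open>tb\<close> are in \<open>I\<close>, as \<open>a\<^sup>2\<close> and \<open>b\<^sup>2\<close> are.\<close>

lemma finite_central_square_roots:
  assumes I: "ideal_on I"
  shows "finite {z \<in> Z - I. m z z \<in> I}" (is "finite ?T")
proof (rule ccontr)
  assume "infinite ?T"
  \<comment> \<open>The colour of a pair records whether its product lies in \<open>I\<close>; it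
    depends only on the unordered pair since the elements are central.\<close>
  define f where "f = (\<lambda>S. if \<exists>s t. S = {s, t} \<and> s \<noteq> t \<and> m s t \<in> I then 0 else 1 :: nat)"
  have f: "f {s, t} = 0 \<longleftrightarrow> m s t \<in> I" if "s \<in> Z" "t \<in> Z" "s \<noteq> t" for s t
    using that center_commute[of s t] center_in by (auto simp: f_def doubleton_eq_iff)
  have "f S < 2" for S by (simp add: f_def)
  then obtain A k where A: "A \<subseteq> ?T" "infinite A" "k < 2"
    and fA: "\<forall>s\<in>A. \<forall>t\<in>A. s \<noteq> t \<longrightarrow> f {s, t} = k"
    using Ramsey2[OF \<open>infinite ?T\<close>, of f 2] by blast
  have AZ: "A \<subseteq> Z" and AX: "A \<subseteq> X" and AI: "A \<inter> I = {}" and sq: "\<And>a. a \<in> A \<Longrightarrow> m a a \<in> I"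
    using A center_in by auto
  define AA where "AA = {m a b |a b. a \<in> A \<and> b \<in> A}"
  have AAZ: "AA \<subseteq> Z" using AZ center_mem by (auto simp: AA_def)
  define J where "J = I \<union> gen AA"
  have J: "ideal_on J" unfolding J_def by (rule ideal_Un_gen[OF I AAZ])
  have "t \<notin> J" if t: "t \<in> A" for t
  proof
    assume "t \<in> J"
    then have "t \<in> gen AA" using t AI by (auto simp: J_def)
    then obtain a b where ab: "a \<in> A" "b \<in> A" "t = m a b \<or> (\<exists>x\<in>X. t = m (m a b) x)"
      by (auto simp: gen_def AA_def)
    note X = subsetD[OF AX ab(1)] subsetD[OF AX ab(2)] subsetD[OF AX t]
    have abI: "m a b \<notin> I"
      using ab(3) t AI ideal_onD(2)[OF I] by auto
    then have "a \<noteq> b" using sq ab by auto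
    have "m t c \<in> I" if c: "c = a \<or> c = b" for c
    proof -
      have c': "c \<in> A" "c \<in> Z" "c \<in> X" using c ab AZ AX by auto
      obtain d where d: "d \<in> A" "d \<in> X" "m a b = m c d"
        using c ab X AZ center_commute[of a b] by (metis subsetD)
      have "m c (m c d) \<in> I" using ideal_onD(2)[OF I sq[OF c'(1)] d(2)] assoc c' d by simp
      then have "m c (m a b) \<in> I" using d by simp
      moreover from this have "m c (m (m a b) x) \<in> I" if "x \<in> X" for x
        using ideal_onD(2)[OF I _ that] assoc[OF c'(3) mem[OF X(1,2)] that] by metis
      ultimately have "m c t \<in> I" using ab(3) by auto
      then show ?thesis using center_commute[OF c'(2) X(3)] by simp
    qed
    \<comment> \<open>At least one of \<open>a\<close>, \<open>b\<close> differs from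
      \<open>t\<close>. Its pair with \<open>t\<close> has colour 0, so all pairs have, contrary to
      \<open>abI\<close>.\<close>
    moreover obtain c where c: "c = a \<or> c = b" "c \<noteq> t" using \<open>a \<noteq> b\<close> by metis
    ultimately have "f {t, c} = 0" using f[of t c] t ab AZ by auto
    then have "k = 0" using fA t c ab by auto
    then show False using fA f[of a b] ab \<open>a \<noteq> b\<close> abI AZ by auto
  qed
  then have "A \<subseteq> (J \<union> gen A) - J" by (auto simp: gen_def)
  \<comment> \<open>Modulo \<open>J\<close> the ideal generated by \<open>A\<close> has zero
    multiplication.\<close>
  moreover have "finite ((J \<union> gen A) - J)"
  proof (rule finite_null_ideal_mod[OF J ideal_Un_gen[OF J AZ]])
    have "m c d \<in> J" if "c \<in> gen A" "d \<in> gen A" for c d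
    proof -
      obtain a where a: "a \<in> A" "c = a \<or> (\<exists>x\<in>X. c = m a x)" using \<open>c \<in> gen A\<close> by (auto simp: gen_def)
      obtain b where b: "b \<in> A" "d = b \<or> (\<exists>x\<in>X. d = m b x)" using \<open>d \<in> gen A\<close> by (auto simp: gen_def)
      have ab: "m a b \<in> J" using a b by (auto simp: J_def gen_def AA_def)
      have aX: "a \<in> X" "b \<in> X" "a \<in> Z" "b \<in> Z" using a b AX AZ by auto
      have *: "m c b \<in> J"
        using a(2)
      proof
        assume "\<exists>x\<in>X. c = m a x"
        then obtain x where x: "x \<in> X" "c = m a x" by blast
        then have "m c b = m (m a b) x" using aX assoc center_commute by simp
        then show ?thesis using ideal_onD(2)[OF J ab] x by simp
      qed (use ab in simp)
      have "c \<in> X" using a(2) aX mem by auto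
      then show ?thesis using b(2) * ideal_onD(2)[OF J *] assoc aX by auto
    qed
    moreover have "x \<in> X" if "x \<in> J \<union> gen A" for x
      using ideal_onD(1)[OF ideal_Un_gen[OF J AZ] that] .
    ultimately show "m c d \<in> J" if "c \<in> J \<union> gen A" "d \<in> J \<union> gen A" for c d
      using that ideal_onD(2)[OF J, of c d] ideal_onD(3)[OF J, of d c] by auto
  qed simp
  ultimately show False using A(2) finite_subset by blast
qed

text \<open>\<open>spow z n\<close> is the power \<open>z\<^bsup>n+1\<^esup>\<close>.\<close>

definition spow :: "'a \<Rightarrow> nat \<Rightarrow> 'a" where
  "spow z n = (m z ^^ n) z"

lemma funpow_mem: "\<lbrakk>z \<in> X; x \<in> X\<rbrakk> \<Longrightarrow> (m z ^^ n) x \<in> X"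
  by (induction n) (auto simp: mem)

lemma funpow_mult: "\<lbrakk>z \<in> X; x \<in> X; y \<in> X\<rbrakk> \<Longrightarrow> m ((m z ^^ n) x) y = (m z ^^ n) (m x y)"
  by (induction n) (auto simp: funpow_mem assoc)

lemma funpow_mult_right: "\<lbrakk>z \<in> Z; x \<in> X; y \<in> X\<rbrakk> \<Longrightarrow> m x ((m z ^^ n) y) = (m z ^^ n) (m x y)"
proof (induction n)
  case (Suc n)
  then show ?case
    using center_left_commute[of z x "(m z ^^ n) y"] funpow_mem[of z y n] center_in[of z] by simp
qed simp

lemma pow_in: "z \<in> X \<Longrightarrow> spow z n \<in> X"
  by (simp add: spow_def funpow_mem)

lemma pow_Suc: "spow z (Suc n) = m z (spow z n)"
  by (simp add: spow_def)

lemma funpow_pow: "(m z ^^ a) (spow z n) = spow z (a + n)"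
  by (simp add: spow_def funpow_add)

lemma pow_mult: "z \<in> X \<Longrightarrow> m (spow z i) (spow z j) = spow z (i + j + 1)"
proof (induction i)
  case 0
  then show ?case by (simp add: spow_def)
next
  case (Suc i)
  then show ?case by (simp add: pow_Suc assoc pow_in)
qed

lemma pow_center: "z \<in> Z \<Longrightarrow> spow z n \<in> Z"
  by (induction n) (auto simp: pow_Suc center_mem, simp add: spow_def)

lemma power_sums_mod_4: "3 * (\<Sum>k<n. 4 ^ k) + 1 = (4 ^ n :: nat)"
  by (induction n) auto

text \<open>Otherwise the partial sums of \<open>\<Sum>4\<^sup>k\<close>, which converge 2-adically to \<open>-1/3\<close>, would provide
  a coherent sequence of powers of \<open>z\<close> without a limit.\<close>

lemma central_pow_not_inj:
  assumes inf: "infinite X" and z: "z \<in> Z"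
  shows "\<not> inj (spow z)"
proof
  assume inj: "inj (spow z)"
  note zX = center_in[OF z]
  \<comment> \<open>Multiplication by powers of \<open>z\<close> extends congruence of exponents
    modulo \<open>4 ^ n\<close> to a congruence on all of \<open>X\<close>, including elements that
    are not powers of \<open>z\<close>.\<close>
  define R where "R = (\<lambda>n x y. \<exists>a b. (m z ^^ a) x = (m z ^^ b) y \<and> a mod 4 ^ n = b mod (4 ^ n :: nat))"
  define s where "s = (\<lambda>n. \<Sum>k<n. 4 ^ k :: nat)"
  have "\<exists>y\<in>X. \<forall>n. R n y (spow z (s n))"
  proof (rule coherent_sequence_realized[OF inf])
    fix n x show "R n x x" unfolding R_def by blast
  next
    fix n x y assume "R n x y" then show "R n y x" unfolding R_def by metis
  next
    fix n x y w assume "R n x y" "R n y w"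
    then obtain a b c d where *: "(m z ^^ a) x = (m z ^^ b) y" "a mod 4 ^ n = b mod (4 ^ n)"
      "(m z ^^ c) y = (m z ^^ d) w" "c mod 4 ^ n = d mod (4 ^ n)"
      unfolding R_def by blast
    have "(m z ^^ (c + a)) x = (m z ^^ (c + b)) y" using *(1) by (simp add: funpow_add)
    also have "\<dots> = (m z ^^ (b + d)) w" using *(3) by (simp add: add.commute[of c b] funpow_add)
    finally have "(m z ^^ (c + a)) x = (m z ^^ (b + d)) w" .
    moreover have "(c + a) mod 4 ^ n = (b + d) mod 4 ^ n"
      using mod_add_cong[OF *(4,2)] by (simp add: add.commute)
    ultimately show "R n x w" unfolding R_def by blast
  next
    fix n x y x' y' assume X: "x \<in> X" "y \<in> X" "x' \<in> X" "y' \<in> X" and "R n x x'" "R n y y'"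
    then obtain a b c d where *: "(m z ^^ a) x = (m z ^^ b) x'" "a mod 4 ^ n = b mod (4 ^ n)"
      "(m z ^^ c) y = (m z ^^ d) y'" "c mod 4 ^ n = d mod (4 ^ n)"
      unfolding R_def by blast
    have "m ((m z ^^ a) x) ((m z ^^ c) y) = (m z ^^ (c + a)) (m x y)"
      "m ((m z ^^ b) x') ((m z ^^ d) y') = (m z ^^ (d + b)) (m x' y')"
      using X zX z by (simp_all add: funpow_mult funpow_mult_right funpow_mem funpow_add)
    then have "(m z ^^ (c + a)) (m x y) = (m z ^^ (d + b)) (m x' y')" using * by simp
    moreover have "(c + a) mod 4 ^ n = (d + b) mod 4 ^ n"
      using *(4,2) by (rule mod_add_cong)
    ultimately show "R n (m x y) (m x' y')" unfolding R_def by blast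
  next
    fix n show "spow z (s n) \<in> X" using zX by (rule pow_in)
  next
    fix n k :: nat assume "n \<le> k"
    then have "s k = s n + (\<Sum>i=n..<k. 4 ^ i)"
      unfolding s_def by (metis atLeast0LessThan sum.atLeastLessThan_concat zero_le)
    moreover have "4 ^ n dvd (\<Sum>i=n..<k. 4 ^ i :: nat)" by (intro dvd_sum) (simp add: le_imp_power_dvd)
    ultimately obtain d where d: "s k = 4 ^ n * d + s n" by (metis add.commute dvdE)
    have "(m z ^^ 0) (spow z (s k)) = (m z ^^ (4 ^ n * d)) (spow z (s n))"
      unfolding spow_def d funpow_add by simp
    moreover have "0 mod 4 ^ n = 4 ^ n * d mod 4 ^ n" by simp
    ultimately show "R n (spow z (s k)) (spow z (s n))" unfolding R_def by blast
  qed
  then obtain y where y: "y \<in> X" "\<And>n. R n y (spow z (s n))" by blast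
  \<comment> \<open>For \<open>n = 0\<close> the modulus is 1, so this only links \<open>y\<close>
    to the powers of \<open>z\<close>. Injectivity then turns each further instance into an equation
    between exponents.\<close>
  obtain a0 b0 where 0: "(m z ^^ a0) y = spow z b0" using y(2)[of 0] by (auto simp: R_def s_def funpow_pow)
  have dvd: "4 ^ n dvd 3 * (int b0 - int a0) + 1" for n
  proof -
    obtain a b where ab: "(m z ^^ a) y = spow z (b + s n)" "a mod 4 ^ n = b mod 4 ^ n"
      using y(2)[of n] by (auto simp: R_def funpow_pow)
    have "spow z (a + b0) = (m z ^^ (a + a0)) y" using 0 funpow_pow by (simp add: funpow_add)
    also have "\<dots> = spow z (a0 + (b + s n))" using ab(1) funpow_pow by (simp add: add.commute[of a] funpow_add)
    finally have "a + b0 = a0 + (b + s n)" using inj by (auto dest: injD)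
    then have *: "int b0 - int a0 = int b - int a + int (s n)" by linarith
    have "int a mod 4 ^ n = int b mod 4 ^ n"
      using ab(2) by (metis of_nat_mod of_nat_numeral of_nat_power)
    then have "(4::int) ^ n dvd int b - int a" by (metis mod_eq_dvd_iff)
    then have "(4::int) ^ n dvd 3 * (int b - int a) + 4 ^ n" by (intro dvd_add dvd_mult) simp_all
    also have "(4::int) ^ n = 3 * int (s n) + 1"
      using power_sums_mod_4[of n] unfolding s_def by (metis of_nat_1 of_nat_add of_nat_mult of_nat_numeral of_nat_power)
    then have "3 * (int b - int a) + 4 ^ n = 3 * (int b0 - int a0) + 1" using * by simp
    finally show ?thesis by simp
  qed
  define w where "w = 3 * (int b0 - int a0) + 1"
  \<comment> \<open>\<open>w\<close> is congruent to 1 modulo 3, yet every power of 4 divides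
    it.\<close>
  have "w \<noteq> 0" unfolding w_def by presburger
  moreover have "\<bar>w\<bar> < 4 ^ nat \<bar>w\<bar>"
  proof -
    have "nat \<bar>w\<bar> < 4 ^ nat \<bar>w\<bar>" by (rule less_exp[THEN less_le_trans]) (simp add: power_mono)
    then show ?thesis by (metis nat_less_iff abs_ge_zero of_nat_numeral of_nat_power)
  qed
  ultimately show False
    using dvd[of "nat \<bar>w\<bar>"] zdvd_imp_le[of "4 ^ nat \<bar>w\<bar>" "\<bar>w\<bar>"] unfolding w_def[symmetric] by auto
qed

text \<open>A coincidence of two powers makes the sequence of powers eventually periodic, and a late
  power whose exponent is a multiple of the period is idempotent.\<close>

lemma central_pow_idempotent:
  assumes inf: "infinite X" and z: "z \<in> Z"
  shows "\<exists>k. m (spow z k) (spow z k) = spow z k"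
proof -
  note zX = center_in[OF z]
  obtain i j where "i < j" "spow z i = spow z j"
    using central_pow_not_inj[OF assms] by (metis injI linorder_neqE_nat)
  then obtain d where d: "d > 0" "spow z i = spow z (i + d)"
    by (metis less_imp_add_positive)
  have step: "spow z (i + t + d) = spow z (i + t)" for t
    using arg_cong[OF d(2), of "m z ^^ t"] by (simp add: funpow_pow ac_simps)
  have period: "spow z (n + c * d) = spow z n" if "n \<ge> i" for n c
  proof (induction c)
    case (Suc c)
    have "spow z (n + Suc c * d) = spow z (i + (n - i + c * d) + d)" using that by (simp add: algebra_simps)
    also have "\<dots> = spow z (n + c * d)" using step[of "n - i + c * d"] that by simp
    finally show ?case using Suc by simp
  qed simp
  \<comment> \<open>The actual exponent of \<open>spow z ?k\<close> is \<open>Suc i * d\<close>: a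
    multiple of the period, beyond the preperiod. Squaring increases it by
    \<open>Suc i * d\<close>.\<close>
  let ?k = "Suc i * d - 1"
  have "Suc i * 1 \<le> Suc i * d" using d(1) by (intro mult_le_mono2) simp
  then have "?k \<ge> i" by simp
  moreover have "?k + ?k + 1 = ?k + Suc i * d" using d(1) by auto
  ultimately have "m (spow z ?k) (spow z ?k) = spow z ?k"
    using pow_mult[OF zX] period by metis
  then show ?thesis by blast
qed

text \<open>The finite set \<open>T\<close> of central square roots of \<open>I\<close> is absorbed
  into a larger ideal \<open>J\<close>, which lowers the number of squarings by one. No other
  central elements are lost, because the square of \<open>tx\<close> is \<open>t\<close> squared
  times \<open>x\<close> squared, so a central element of \<open>J\<close> outside \<open>I\<close>
  is again in \<open>T\<close>.\<close>

lemma finite_central_roots: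
  "ideal_on I \<Longrightarrow> finite {z \<in> Z - I. ((\<lambda>x. m x x) ^^ k) z \<in> I}"
proof (induction k arbitrary: I)
  case (Suc k)
  define T where "T = {z \<in> Z - I. m z z \<in> I}"
  define J where "J = I \<union> gen T"
  have T: "finite T" unfolding T_def by (rule finite_central_square_roots[OF Suc.prems])
  have J: "ideal_on J" unfolding J_def by (rule ideal_Un_gen[OF Suc.prems]) (auto simp: T_def)
  have "z \<in> T" if z: "z \<in> Z" "z \<notin> I" "z \<in> J" for z
  proof -
    have "z \<in> gen T" using z by (simp add: J_def)
    moreover have "m (m t x) (m t x) \<in> I" if t: "t \<in> T" and x: "x \<in> X" for t x
    proof -
      have tZ: "t \<in> Z" "m t t \<in> I" using t by (auto simp: T_def)
      note X = center_in[OF tZ(1)]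
      have "m (m t x) (m t x) = m t (m x (m t x))" by (rule assoc[OF X x mem[OF X x]])
      also have "m x (m t x) = m t (m x x)" by (rule center_left_commute[OF tZ(1) x x])
      also have "m t (m t (m x x)) = m (m t t) (m x x)" using assoc[OF X X mem[OF x x]] by simp
      finally show ?thesis using ideal_onD(2)[OF Suc.prems tZ(2) mem[OF x x]] by simp
    qed
    ultimately show ?thesis using z by (auto simp: gen_def T_def)
  qed
  moreover have "((\<lambda>x. m x x) ^^ k) z \<in> J" if z: "z \<in> Z" "((\<lambda>x. m x x) ^^ Suc k) z \<in> I" for z
  proof -
    have "((\<lambda>x. m x x) ^^ k) z \<in> Z" using z(1) by (induction k) (auto simp: center_mem)
    then show ?thesis using z(2) by (auto simp: J_def T_def gen_def)
  qed
  ultimately have "{z \<in> Z - I. ((\<lambda>x. m x x) ^^ Suc k) z \<in> I} \<subseteq> {z \<in> Z - J. ((\<lambda>x. m x x) ^^ k) z \<in> J} \<union> T"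
    by blast
  then show ?case using finite_subset Suc.IH[OF J] T by blast
qed auto

lemma square_funpow: "z \<in> X \<Longrightarrow> ((\<lambda>x. m x x) ^^ k) z = spow z (2 ^ k - 1)"
proof (induction k)
  case (Suc k)
  have "2 ^ k - 1 + (2 ^ k - 1) + 1 = (2 ^ Suc k - 1 :: nat)"
    using one_le_power[of "2::nat" k] unfolding power_Suc by linarith
  then show ?case using Suc pow_mult[of z "2 ^ k - 1" "2 ^ k - 1"] by simp
qed (simp add: spow_def)

text \<open>The number of central square roots of \<open>I\<close> bounds the nilpotency index: the
  later half of the powers of \<open>z\<close> preceding its entry into \<open>I\<close> consists of
  distinct square roots. With a uniform bound, a fixed number of squarings sends all of
  \<open>Z\<close> into \<open>I\<close>.\<close>

lemma finite_center_minus_ideal: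
  assumes I: "ideal_on I" and nil: "\<And>z. z \<in> Z \<Longrightarrow> \<exists>k. spow z k \<in> I"
  shows "finite (Z - I)"
proof -
  define T where "T = {z \<in> Z - I. m z z \<in> I}"
  have T: "finite T" unfolding T_def by (rule finite_central_square_roots[OF I])
  define c where "c = card T"
  have up: "spow z n \<in> I" if "z \<in> X" "spow z d \<in> I" "d \<le> n" for z d n
    using that(3)
  proof (induction rule: dec_induct)
    case (step n)
    then show ?case using ideal_onD(3)[OF I _ that(1)] by (simp add: pow_Suc)
  qed (rule that)
  have bound: "spow z (2 * c + 2) \<in> I" if z: "z \<in> Z" for z
  proof -
    note zX = center_in[OF z]
    define d where "d = (LEAST d. spow z d \<in> I)"
    have d: "spow z d \<in> I" unfolding d_def using nil[OF z] by (rule LeastI_ex)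
    have least: "spow z j \<notin> I" if "j < d" for j using that not_less_Least unfolding d_def by blast
    have "d \<le> 2 * c + 2"
    proof (rule ccontr)
      assume big: "\<not> d \<le> 2 * c + 2"
      have "spow z j \<noteq> spow z k" if jk: "j < k" "k < d" for j k
      proof
        assume "spow z j = spow z k"
        then have "spow z (d - k + j) = spow z (d - k + k)" by (metis funpow_pow)
        moreover have "d - k + j < d" "d - k + k = d" using jk by linarith+
        ultimately show False using d least by metis
      qed
      \<comment> \<open>These are the last \<open>c + 1\<close> powers before \<open>d\<close>, one
        more than \<open>T\<close> has elements; \<open>d\<close> is large enough for their squares
        to lie in \<open>I\<close>.\<close>
      then have "inj_on (spow z) {d - 1 - c..<d}"
        by (metis (no_types, lifting) atLeastLessThan_iff inj_onI linorder_neqE_nat)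
      moreover have "spow z ` {d - 1 - c..<d} \<subseteq> T"
      proof (rule image_subsetI)
        fix j assume j: "j \<in> {d - 1 - c..<d}"
        then have "d \<le> j + j + 1" using big by auto
        then have "m (spow z j) (spow z j) \<in> I" using up[OF zX d] pow_mult[OF zX] by simp
        then show "spow z j \<in> T" using j least pow_center[OF z] by (simp add: T_def)
      qed
      ultimately have "card {d - 1 - c..<d} \<le> c"
        unfolding c_def using T by (rule card_inj_on_le)
      then show False using big by simp
    qed
    then show ?thesis by (rule up[OF zX d])
  qed
  define k where "k = 2 * c + 3"
  have "2 * c + 2 \<le> 2 ^ k - 1" using less_exp[of k] unfolding k_def by linarith
  then have "((\<lambda>x. m x x) ^^ k) z \<in> I" if "z \<in> Z" for z
    using up[OF center_in[OF that] bound[OF that]] square_funpow[OF center_in[OF that]] by simp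
  then have "Z - I \<subseteq> {z \<in> Z - I. ((\<lambda>x. m x x) ^^ k) z \<in> I}" by blast
  then show ?thesis using finite_central_roots[OF I] finite_subset by blast
qed

end

section \<open>Torsion abelian groups\<close>

context comm_group
begin

definition word :: "(nat \<Rightarrow> 'a) \<Rightarrow> (nat \<Rightarrow> nat) \<Rightarrow> nat \<Rightarrow> 'a" where
  "word a c n = finprod G (\<lambda>i. a i [^] c i) {..<n}"

text \<open>Exponents are natural numbers, so this is the submonoid generated by the first
  \<open>n\<close> terms; in a torsion group it is the subgroup they generate.\<close>

definition words :: "(nat \<Rightarrow> 'a) \<Rightarrow> nat \<Rightarrow> 'a set" where
  "words a n = range (\<lambda>c. word a c n)"

context
  fixes a :: "nat \<Rightarrow> 'a"
  assumes a: "\<And>n. a n \<in> carrier G"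
begin

lemma word_0 [simp]: "word a c 0 = \<one>"
  by (simp add: word_def)

lemma word_closed [simp]: "word a c n \<in> carrier G"
  unfolding word_def using a by (intro finprod_closed) auto

lemma word_Suc: "word a c (Suc n) = a n [^] c n \<otimes> word a c n"
  unfolding word_def lessThan_Suc using a by (subst finprod_insert) auto

lemma word_cong: "(\<And>i. i < n \<Longrightarrow> c i = d i) \<Longrightarrow> word a c n = word a d n"
  by (induction n) (auto simp: word_Suc)

lemma word_one: "(\<And>i. i < n \<Longrightarrow> a i [^] c i = \<one>) \<Longrightarrow> word a c n = \<one>"
  by (induction n) (auto simp: word_Suc)

lemma word_add: "word a (\<lambda>i. c i + d i) n = word a c n \<otimes> word a d n"
  by (induction n) (use a in \<open>auto simp: word_Suc nat_pow_mult[symmetric] m_ac\<close>)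

lemma word_split:
  "n \<le> l \<Longrightarrow> word a c l = word a c n \<otimes> word a (\<lambda>i. if i < n then 0 else c i) l"
proof (induction rule: dec_induct)
  case base
  have "word a (\<lambda>i. if i < n then 0 else c i) n = \<one>" by (rule word_one) simp
  then show ?case by simp
next
  case (step l)
  then show ?case using a by (simp add: word_Suc m_lcomm)
qed

lemma word_extend: "n \<le> l \<Longrightarrow> word a c n = word a (\<lambda>i. if i < n then c i else 0) l"
proof (induction rule: dec_induct)
  case base
  show ?case by (rule word_cong) simp
qed (simp add: word_Suc)

lemma words_Suc: "words a (Suc n) = {a n [^] (j::nat) \<otimes> w |j w. w \<in> words a n}" (is "_ = ?R")
proof
  show "words a (Suc n) \<subseteq> ?R" by (auto simp: words_def word_Suc)
  show "?R \<subseteq> words a (Suc n)"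
  proof
    fix x assume "x \<in> ?R"
    then obtain j :: nat and c where "x = a n [^] j \<otimes> word a c n" by (auto simp: words_def)
    then have "x = word a (c(n := j :: nat)) (Suc n)"
      by (simp add: word_Suc word_cong[of n "c(n := j)" c])
    then show "x \<in> words a (Suc n)" by (auto simp: words_def)
  qed
qed

lemma words_mono: "n \<le> l \<Longrightarrow> words a n \<subseteq> words a l"
  unfolding words_def using word_extend by blast

lemma words_mult: "\<lbrakk>x \<in> words a n; y \<in> words a n\<rbrakk> \<Longrightarrow> x \<otimes> y \<in> words a n"
  unfolding words_def by (auto simp flip: word_add)

lemma words_pow: "x \<in> words a n \<Longrightarrow> x [^] (k::nat) \<in> words a n"
proof (induction k)
  case 0
  have "\<one> = word a (\<lambda>_. 0) n" by (rule word_one[symmetric]) simp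
  then show ?case by (auto simp: words_def)
qed (simp add: words_mult)

lemma words_inv:
  assumes tor: "\<And>x. x \<in> carrier G \<Longrightarrow> \<exists>k>0. x [^] (k::nat) = \<one>" and x: "x \<in> words a n"
  shows "inv x \<in> words a n"
proof -
  have xG: "x \<in> carrier G" using x by (auto simp: words_def)
  then obtain k :: nat where k: "k > 0" "x [^] k = \<one>" using tor by blast
  then have "x [^] (k - 1) \<otimes> x = \<one>" using xG by (metis Suc_diff_1 nat_pow_Suc)
  then have "inv x = x [^] (k - 1)" using xG by (intro inv_equality) auto
  then show ?thesis using words_pow[OF x] by simp
qed

text \<open>The highest coordinate is compared first: unequal exponents differ by at most
  \<open>r\<close>, and cancelling would put a small positive power of \<open>a n\<close> into
  \<open>words a n\<close>. The factor \<open>h\<close> does no harm, as it only involves terms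
  before \<open>M\<close>, where \<open>c\<close> and \<open>d\<close> vanish.\<close>

lemma word_unique:
  assumes tor: "\<And>x. x \<in> carrier G \<Longrightarrow> \<exists>k>0. x [^] (k::nat) = \<one>"
    and indep: "\<And>n j. \<lbrakk>M \<le> n; 1 \<le> j; j \<le> r\<rbrakk> \<Longrightarrow> a n [^] (j::nat) \<notin> words a n"
    and c: "\<And>n. c n \<le> r" "\<And>n. n < M \<Longrightarrow> c n = 0"
    and d: "\<And>n. d n \<le> r" "\<And>n. n < M \<Longrightarrow> d n = 0"
    and h: "h \<in> words a M"
  shows "word a c n = h \<otimes> word a d n \<Longrightarrow> i < n \<Longrightarrow> c i = d i"
proof (induction n arbitrary: i)
  case (Suc n)
  have hG: "h \<in> carrier G" using h by (auto simp: words_def)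
  have eq: "a n [^] c n \<otimes> word a c n = h \<otimes> (a n [^] d n \<otimes> word a d n)"
    using Suc.prems(1) by (simp add: word_Suc)
  have cd: "c n = d n"
  proof (cases "n < M")
    case True
    then show ?thesis using c d by simp
  next
    case False
    then have hn: "h \<in> words a n" using h words_mono[of M n] by auto
    note inv = words_inv[OF tor] and W = rangeI[of "\<lambda>c. word a c n", folded words_def]
    have "\<not> d n < c n"
    proof
      assume *: "d n < c n"
      have "a n [^] c n = a n [^] d n \<otimes> a n [^] (c n - d n)"
        using a * by (simp add: nat_pow_mult)
      then have "a n [^] d n \<otimes> (a n [^] (c n - d n) \<otimes> word a c n) = a n [^] d n \<otimes> (h \<otimes> word a d n)"
        using eq a hG by (simp add: m_ac)
      then have "a n [^] (c n - d n) \<otimes> word a c n = h \<otimes> word a d n"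
        using a hG by simp
      then have "a n [^] (c n - d n) = h \<otimes> word a d n \<otimes> inv (word a c n)"
        using a hG by (metis inv_solve_right m_closed nat_pow_closed word_closed)
      moreover have "h \<otimes> word a d n \<otimes> inv (word a c n) \<in> words a n"
        by (intro words_mult inv hn W)
      moreover have "1 \<le> c n - d n" "c n - d n \<le> r" using * c(1)[of n] by linarith+
      ultimately show False using indep[of n "c n - d n"] False by simp
    qed
    moreover have "\<not> c n < d n"
    proof
      assume *: "c n < d n"
      have "a n [^] d n = a n [^] c n \<otimes> a n [^] (d n - c n)"
        using a * by (simp add: nat_pow_mult)
      then have "a n [^] c n \<otimes> (a n [^] (d n - c n) \<otimes> (h \<otimes> word a d n)) = a n [^] c n \<otimes> word a c n"
        using eq a hG by (simp add: m_ac)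
      then have "a n [^] (d n - c n) \<otimes> (h \<otimes> word a d n) = word a c n"
        using a hG by simp
      then have "a n [^] (d n - c n) = word a c n \<otimes> inv (h \<otimes> word a d n)"
        using a hG by (metis inv_solve_right m_closed nat_pow_closed word_closed)
      moreover have "word a c n \<otimes> inv (h \<otimes> word a d n) \<in> words a n"
        by (intro words_mult inv hn W)
      moreover have "1 \<le> d n - c n" "d n - c n \<le> r" using * d(1)[of n] by linarith+
      ultimately show False using indep[of n "d n - c n"] False by simp
    qed
    ultimately show ?thesis by simp
  qed
  have "a n [^] c n \<otimes> word a c n = a n [^] c n \<otimes> (h \<otimes> word a d n)"
    using eq a hG cd by (simp add: m_lcomm)
  then have "word a c n = h \<otimes> word a d n" using a hG by simp
  then show ?case using Suc.IH cd Suc.prems(2) less_Suc_eq by blast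
qed simp

end

text \<open>A recursive choice: torsion keeps the set of words in the terms chosen so far finite, so
  the next term can be chosen relative to all of them.\<close>

lemma sequence_avoiding_words:
  assumes tor: "\<And>x. x \<in> carrier G \<Longrightarrow> \<exists>k>0. x [^] (k::nat) = \<one>"
    and P: "\<And>n S. \<lbrakk>finite S; S \<subseteq> carrier G\<rbrakk> \<Longrightarrow> \<exists>x\<in>carrier G. P n S x"
  shows "\<exists>a. (\<forall>n. a n \<in> carrier G) \<and> (\<forall>n. P n (words a n) (a n))"
proof -
  define pick where "pick = (\<lambda>n S. SOME x. x \<in> carrier G \<and> P n S x)"
  have pick: "pick n S \<in> carrier G \<and> P n S (pick n S)" if "finite S" "S \<subseteq> carrier G" for n S
    unfolding pick_def by (rule someI_ex) (use P[OF that] in blast)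
  \<comment> \<open>The recursion runs over the sets of words, which determine the next term; the
    sequence is read off afterwards.\<close>
  define S where "S = rec_nat {\<one>} (\<lambda>n S. {pick n S [^] (j::nat) \<otimes> w |j w. w \<in> S})"
  have S_0: "S 0 = {\<one>}" and S_Suc: "S (Suc n) = {pick n (S n) [^] (j::nat) \<otimes> w |j w. w \<in> S n}" for n
    by (simp_all add: S_def)
  have fin: "finite (S n) \<and> S n \<subseteq> carrier G" for n
  proof (induction n)
    case (Suc n)
    let ?x = "pick n (S n)"
    have x: "?x \<in> carrier G" using Suc pick by blast
    then obtain k :: nat where k: "k > 0" "?x [^] k = \<one>" using tor by blast
    have *: "?x [^] j = ?x [^] (j mod k)" for j :: nat
    proof -
      have "?x [^] j = ?x [^] (k * (j div k) + j mod k)" by simp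
      also have "\<dots> = (?x [^] k) [^] (j div k) \<otimes> ?x [^] (j mod k)"
        using x by (simp only: nat_pow_mult[symmetric] nat_pow_pow)
      finally show ?thesis using k x by simp
    qed
    have "S (Suc n) \<subseteq> (\<lambda>(j, w). ?x [^] j \<otimes> w) ` ({..<k} \<times> S n)"
    proof (clarsimp simp: S_Suc)
      fix j :: nat and w assume "w \<in> S n"
      then show "?x [^] j \<otimes> w \<in> (\<lambda>(j, w). ?x [^] j \<otimes> w) ` ({..<k} \<times> S n)"
        using k(1) * by (intro image_eqI[of _ _ "(j mod k, w)"]) auto
    qed
    moreover have "finite ((\<lambda>(j, w). ?x [^] j \<otimes> w) ` ({..<k} \<times> S n))" using Suc by simp
    ultimately have "finite (S (Suc n))" using finite_subset by blast
    moreover have "S (Suc n) \<subseteq> carrier G" using Suc x unfolding S_Suc by auto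
    ultimately show ?case by blast
  qed (simp add: S_0)
  define a where "a = (\<lambda>n. pick n (S n))"
  have a: "a n \<in> carrier G" "P n (S n) (a n)" for n using fin pick by (auto simp: a_def)
  have "words a n = S n" for n
  proof (induction n)
    case 0
    then show ?case by (auto simp: words_def word_0[of a, OF a(1)] S_0)
  next
    case (Suc n)
    then show ?case unfolding words_Suc[of a, OF a(1)] S_Suc by (simp add: a_def)
  qed
  then show ?thesis using a by metis
qed

text \<open>Write \<open>N = p * q\<close>. If the \<open>q\<close>-torsion is finite, then the
  \<open>p\<close>-th power map on the \<open>N\<close>-torsion has an infinite fibre, and
  translating that fibre by the inverse of one of its points lands in the
  \<open>p\<close>-torsion.\<close>

lemma infinite_prime_torsion:
  "\<lbrakk>N > 0; infinite {x \<in> carrier G. x [^] (N::nat) = \<one>}\<rbrakk>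
    \<Longrightarrow> \<exists>p::nat. prime p \<and> infinite {x \<in> carrier G. x [^] p = \<one>}"
proof (induction N rule: less_induct)
  case (less N)
  have "{x \<in> carrier G. x [^] (1::nat) = \<one>} \<subseteq> {\<one>}" by auto
  then have "N \<noteq> 1" using less.prems(2) finite_subset by blast
  then obtain p where p: "prime p" "p dvd N" using prime_factor_nat by blast
  then obtain q where q: "N = p * q" by blast
  have "1 < p" using p(1) prime_gt_1_nat by blast
  have q0: "0 < q" "q < N" using q less.prems(1) \<open>1 < p\<close> by auto
  let ?T = "\<lambda>n::nat. {x \<in> carrier G. x [^] n = \<one>}"
  show ?case
  proof (cases "finite (?T q)")
    case False
    then show ?thesis using less.IH[OF q0(2,1)] by simp
  next
    case True
    have "(\<lambda>x. x [^] p) ` ?T N \<subseteq> ?T q" by (auto simp: nat_pow_pow q)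
    then have "finite ((\<lambda>x. x [^] p) ` ?T N)" using True finite_subset by blast
    then obtain x0 where x0: "x0 \<in> ?T N" "infinite {x \<in> ?T N. x [^] p = x0 [^] p}"
      using pigeonhole_infinite[OF less.prems(2)] by blast
    have "inj_on (\<lambda>x. x \<otimes> inv x0) {x \<in> ?T N. x [^] p = x0 [^] p}"
      using x0 by (auto simp: inj_on_def)
    moreover have "(\<lambda>x. x \<otimes> inv x0) ` {x \<in> ?T N. x [^] p = x0 [^] p} \<subseteq> ?T p"
      using x0 by (auto simp: nat_pow_distrib nat_pow_inv)
    ultimately have "infinite (?T p)" using x0(2) inj_on_finite by blast
    then show ?thesis using p(1) by blast
  qed
qed

text \<open>In the \<open>p\<close>-torsion, seen as a vector space over the field with
  \<open>p\<close> elements, an independent sequence is chosen. The \<open>g n\<close> are its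
  partial products and \<open>H n\<close> is the span of the tail from \<open>n\<close> on; a limit
  would have infinitely many nonzero coordinates.\<close>

lemma incomplete_subgroup_filtration:
  assumes inf: "infinite (carrier G)" and K: "K > 0" "\<And>x. x \<in> carrier G \<Longrightarrow> x [^] (K::nat) = \<one>"
  shows "\<exists>H g. (\<forall>n::nat. subgroup (H n) G \<and> g n \<in> carrier G) \<and>
    (\<forall>n k. n \<le> k \<longrightarrow> (\<exists>h\<in>H n. g k = h \<otimes> g n)) \<and>
    \<not> (\<exists>x\<in>carrier G. \<forall>n. \<exists>h\<in>H n. x = h \<otimes> g n)"
proof -
  have tor: "\<exists>k>0. x [^] (k::nat) = \<one>" if "x \<in> carrier G" for x using K that by blast
  have "{x \<in> carrier G. x [^] K = \<one>} = carrier G" using K by auto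
  then obtain p :: nat where p: "prime p" and infp: "infinite {x \<in> carrier G. x [^] p = \<one>}"
    using infinite_prime_torsion[OF K(1)] inf by auto
  have "\<exists>x\<in>carrier G. x [^] p = \<one> \<and> x \<notin> S" if "finite S" for S
    using infp that by (metis (mono_tags, lifting) finite_subset mem_Collect_eq subsetI)
  then obtain a where a: "\<And>n. a n \<in> carrier G" and ap: "\<And>n. a n [^] p = \<one>"
    and aw: "\<And>n. a n \<notin> words a n"
    using sequence_avoiding_words[OF tor, of "\<lambda>_ S x. x [^] p = \<one> \<and> x \<notin> S"] by metis
  note [simp] = a word_closed[of a, OF a]
  have mod: "a n [^] j = a n [^] (j mod p)" for n j :: nat
  proof -
    have "a n [^] j = a n [^] (p * (j div p) + j mod p)" by simp
    also have "\<dots> = (a n [^] p) [^] (j div p) \<otimes> a n [^] (j mod p)"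
      using a by (simp only: nat_pow_mult[symmetric] nat_pow_pow)
    finally show ?thesis using ap by simp
  qed
  have word_mod: "word a c n = word a (\<lambda>i. c i mod p) n" for c n
    unfolding word_def using mod by (intro finprod_cong) auto
  have indep: "a n [^] j \<notin> words a n" if "1 \<le> j" "j \<le> p - 1" for n j :: nat
  proof
    assume w: "a n [^] j \<in> words a n"
    have "coprime j p" using p that by (metis One_nat_def Suc_le_eq coprime_commute le_less_trans
        diff_less nat_dvd_not_less prime_gt_0_nat prime_imp_coprime_nat zero_less_one order_le_less_trans)
    then obtain i where "[j * i = 1] (mod p)" using cong_solve_coprime_nat[of j p] by auto
    then have "a n [^] (j * i) = a n [^] (1::nat)" using mod by (metis cong_def)
    then have "a n = (a n [^] j) [^] i" by (simp add: nat_pow_pow)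
    then show False using words_pow[of a, OF a w, of i] aw[of n] by simp
  qed
  define H where "H = (\<lambda>n. {word a c l |c l. \<forall>i<n. c i = 0})"
  define g where "g = word a (\<lambda>_. 1)"
  have H_I: "word a c l \<in> H n" if "\<forall>i<n. c i = 0" for c l n
    unfolding H_def using that by blast
  have one_H: "\<one> \<in> H n" for n
    using H_I[of n "\<lambda>_. 0" 0] by (simp add: word_0[of a, OF a])
  have "subgroup (H n) G" for n
  proof (rule subgroupI)
    show "H n \<subseteq> carrier G" by (auto simp: H_def)
    show "H n \<noteq> {}" using one_H by blast
  next
    fix x assume "x \<in> H n"
    then obtain c l where c: "x = word a c l" "\<forall>i<n. c i = 0" by (auto simp: H_def)
    have "word a (\<lambda>i. (p - 1) * c i) l \<otimes> word a c l = word a (\<lambda>i. (p - 1) * c i + c i) l"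
      by (simp add: word_add[of a, OF a])
    also have "(\<lambda>i. (p - 1) * c i + c i) = (\<lambda>i. p * c i)"
      using prime_gt_0_nat[OF p] by (auto simp: algebra_simps fun_eq_iff mult_eq_if)
    also have "word a (\<lambda>i. p * c i) l = \<one>"
      using ap by (intro word_one[of a, OF a]) (simp add: nat_pow_pow[symmetric])
    finally have "inv x = word a (\<lambda>i. (p - 1) * c i) l" using c by (intro inv_equality) auto
    then show "inv x \<in> H n" using c H_I by simp
  next
    fix x y assume "x \<in> H n" "y \<in> H n"
    then obtain c k d l where c: "x = word a c k" "\<forall>i<n. c i = 0" "y = word a d l" "\<forall>i<n. d i = 0"
      by (auto simp: H_def)
    let ?c = "\<lambda>i. if i < k then c i else 0" and ?d = "\<lambda>i. if i < l then d i else 0"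
    have "x \<otimes> y = word a (\<lambda>i. ?c i + ?d i) (max k l)"
      unfolding word_add[of a, OF a] c using word_extend[of a, OF a, of k "max k l" c] word_extend[of a, OF a, of l "max k l" d]
      by simp
    then show "x \<otimes> y \<in> H n" using c H_I by simp
  qed
  moreover have "\<exists>h\<in>H n. g k = h \<otimes> g n" if "n \<le> k" for n k
  proof
    show "g k = word a (\<lambda>i. if i < n then 0 else 1) k \<otimes> g n"
      unfolding g_def using word_split[of a, OF a that, of "\<lambda>_. 1"] by (simp add: m_comm)
    show "word a (\<lambda>i. if i < n then 0 else 1) k \<in> H n" by (rule H_I) simp
  qed
  moreover have "\<not> (\<exists>x\<in>carrier G. \<forall>n. \<exists>h\<in>H n. x = h \<otimes> g n)"
  proof
    assume "\<exists>x\<in>carrier G. \<forall>n. \<exists>h\<in>H n. x = h \<otimes> g n"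
    then obtain x where x: "x \<in> carrier G" "\<And>n. \<exists>h\<in>H n. x = h \<otimes> g n" by blast
    \<comment> \<open>The condition at \<open>0\<close> puts \<open>x\<close> into the span of
      finitely many terms and so fixes an \<open>L\<close> with trivial coordinate in
      \<open>x\<close>; the condition at \<open>Suc L\<close> demands the coordinate 1
      there.\<close>
    obtain h where "h \<in> H 0" "x = h \<otimes> g 0" using x(2) by blast
    then obtain c L where xw: "x = word a c L" by (auto simp: H_def g_def word_0[of a, OF a])
    obtain h where h: "h \<in> H (Suc L)" "x = h \<otimes> g (Suc L)" using x(2) by blast
    then obtain d l where d: "h = word a d l" "\<forall>i<Suc L. d i = 0" by (auto simp: H_def)
    \<comment> \<open>Reduction modulo \<open>p\<close> brings the exponents below the bound
      \<open>r = p - 1\<close> required for \<open>word_unique\<close>.\<close>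
    define d' where "d' = (\<lambda>i. d i mod p)"
    have d': "h = word a d' l" unfolding d'_def using d(1) word_mod by simp
    have xL: "x \<in> words a L" using xw by (auto simp: words_def)
    then have xS: "x \<in> words a (Suc L)" using words_mono[of a, OF a, of L "Suc L"] by auto
    have gS: "g (Suc L) \<in> words a (Suc L)" by (auto simp: g_def words_def)
    have gG: "g n \<in> carrier G" for n by (simp add: g_def)
    define k where "k = x \<otimes> inv (g (Suc L))"
    have k: "k \<in> words a (Suc L)" unfolding k_def by (intro words_mult[of a, OF a] words_inv[of a, OF a tor] xS gS)
    have hG: "h \<in> carrier G" using d by simp
    have hk: "h = k" unfolding k_def using h(2) hG gG by (simp add: m_assoc)
    have "d' i = 0" if "i < l" for i
    proof (rule word_unique[of a, OF a tor, where M = "Suc L" and r = "p - 1" and h = k and c = d' and d = "\<lambda>_. 0" and n = l and i = i])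
      show "word a d' l = k \<otimes> word a (\<lambda>_. 0) l"
        using d' hk hG word_one[of a, OF a, of l "\<lambda>_. 0"] by simp
      show "d' n \<le> p - 1" for n
        using prime_gt_0_nat[OF p] unfolding d'_def by (metis Suc_pred' less_Suc_eq_le mod_less_divisor)
    qed (use indep k d that in \<open>auto simp: d'_def\<close>)
    then have "h = \<one>" unfolding d' by (intro word_one[of a, OF a]) simp
    then have "x = a L \<otimes> g L" using h(2) gG by (simp add: g_def word_Suc[of a, OF a])
    then have "a L = x \<otimes> inv (g L)" using gG by (simp add: m_assoc)
    moreover have "x \<otimes> inv (g L) \<in> words a L"
      by (intro words_mult[of a, OF a] words_inv[of a, OF a tor] xL) (auto simp: g_def words_def)
    ultimately show False using aw[of L] by simp
  qed
  moreover have "g n \<in> carrier G" for n by (simp add: g_def)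
  ultimately show ?thesis by blast
qed

text \<open>\<open>B n j\<close> will be the set of products of \<open>j\<close> terms, with
  repetition, of a sequence from index \<open>n\<close> on. The properties are what
  \<open>core_bounded\<close> needs for its neighbourhoods: products for continuity, monotonicity
  for intersections, the fifth for separation, the sixth for clopenness, and the last to have the
  new point in the closure.\<close>

lemma incomplete_monoid_filtration:
  assumes tor: "\<And>x. x \<in> carrier G \<Longrightarrow> \<exists>k>0. x [^] (k::nat) = \<one>"
    and unb: "\<And>K. \<exists>x\<in>carrier G. \<forall>k::nat. 1 \<le> k \<and> k \<le> K \<longrightarrow> x [^] k \<noteq> \<one>"
  obtains B :: "nat \<Rightarrow> nat \<Rightarrow> 'a set" where
    "\<And>n j. B n j \<subseteq> carrier G" and "\<And>n. \<one> \<in> B n 0"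
    and "\<And>n i j x y. \<lbrakk>x \<in> B n i; y \<in> B n j\<rbrakk> \<Longrightarrow> x \<otimes> y \<in> B n (i + j)"
    and "\<And>k n j. k \<le> n \<Longrightarrow> B n j \<subseteq> B k j"
    and "\<And>g j. \<forall>n. g \<in> B n j \<Longrightarrow> j = 0 \<and> g = \<one>"
    and "\<And>g k l n. g \<in> carrier G \<Longrightarrow> \<exists>M. \<forall>i j. \<forall>w\<in>B n i. \<forall>w'\<in>B M j.
      i \<le> k \<longrightarrow> j \<le> l \<longrightarrow> w = g \<otimes> w' \<longrightarrow> (\<exists>i'. g \<in> B n i' \<and> i = i' + j)"
    and "\<And>n. B n 1 \<noteq> {}"
proof -
  have "\<exists>x\<in>carrier G. \<forall>j::nat. 1 \<le> j \<and> j \<le> n \<longrightarrow> x [^] j \<notin> S"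
    if S: "finite S" "S \<subseteq> carrier G" for S n
  proof -
    obtain o' where o': "\<And>s. s \<in> S \<Longrightarrow> o' s > 0 \<and> s [^] (o' s :: nat) = \<one>"
      using tor S(2) by (metis subsetD)
    \<comment> \<open>\<open>N\<close> is a common exponent for \<open>S\<close>. If the first
      \<open>n * N\<close> powers of \<open>x\<close> are nontrivial, then none of its first
      \<open>n\<close> powers can lie in \<open>S\<close>.\<close>
    define N where "N = prod o' S"
    have N: "N > 0" unfolding N_def using o' by (intro prod_pos) auto
    have SN: "s [^] N = \<one>" if "s \<in> S" for s
    proof -
      have "o' s dvd N" unfolding N_def using S(1) that by (rule dvd_prodI)
      then obtain d where "N = o' s * d" by blast
      then show ?thesis using o'[OF that] S(2) that by (auto simp flip: nat_pow_pow)
    qed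
    obtain x where x: "x \<in> carrier G" "\<And>k::nat. \<lbrakk>1 \<le> k; k \<le> n * N\<rbrakk> \<Longrightarrow> x [^] k \<noteq> \<one>"
      using unb by blast
    have "x [^] j \<notin> S" if j: "1 \<le> j" "j \<le> n" for j :: nat
    proof
      assume "x [^] j \<in> S"
      then have "x [^] (j * N) = \<one>" using SN x(1) by (simp flip: nat_pow_pow)
      then show False using x(2)[of "j * N"] j N by simp
    qed
    then show ?thesis using x(1) by blast
  qed
  then obtain a where a: "\<And>n. a n \<in> carrier G"
    and indep: "\<And>n j. \<lbrakk>1 \<le> j; j \<le> n\<rbrakk> \<Longrightarrow> a n [^] (j::nat) \<notin> words a n"
    using sequence_avoiding_words[OF tor, of "\<lambda>n S x. \<forall>j::nat. 1 \<le> j \<and> j \<le> n \<longrightarrow> x [^] j \<notin> S"]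
    by metis
  note [simp] = a word_closed[of a, OF a]
  define B where "B = (\<lambda>n j. {word a c l |c l. (\<forall>i<n. c i = 0) \<and> sum c {..<l} = j})"
  have B_I: "word a c l \<in> B n (sum c {..<l})" if "\<forall>i<n. c i = 0" for c l n
    unfolding B_def using that by blast
  have B_E: "\<exists>c l. x = word a c l \<and> (\<forall>i<n. c i = 0) \<and> sum c {..<l} = j" if "x \<in> B n j" for x n j
    using that unfolding B_def by blast
  have sum_ext: "sum (\<lambda>i. if i < k then c i else 0) {..<l} = sum c {..<k}" if "k \<le> l"
    for k l and c :: "nat \<Rightarrow> nat"
    using that by (intro sum.mono_neutral_cong_right) auto
  have B_mult: "x \<otimes> y \<in> B n (i + j)" if xy: "x \<in> B n i" "y \<in> B n j" for x y n i j
  proof -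
    obtain c k where c: "x = word a c k" "\<forall>i<n. c i = 0" "sum c {..<k} = i" using B_E[OF xy(1)] by blast
    obtain d l where d: "y = word a d l" "\<forall>i<n. d i = 0" "sum d {..<l} = j" using B_E[OF xy(2)] by blast
    let ?c = "\<lambda>i. if i < k then c i else 0" and ?d = "\<lambda>i. if i < l then d i else 0"
    have "x \<otimes> y = word a (\<lambda>i. ?c i + ?d i) (max k l)"
      unfolding word_add[of a, OF a] c d using word_extend[of a, OF a, of k "max k l" c] word_extend[of a, OF a, of l "max k l" d]
      by simp
    moreover have "sum (\<lambda>i. ?c i + ?d i) {..<max k l} = i + j"
      unfolding sum.distrib using sum_ext[of k "max k l" c] sum_ext[of l "max k l" d] c d by simp
    ultimately show ?thesis using B_I[of n "\<lambda>i. ?c i + ?d i" "max k l"] c d by simp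
  qed
  have le: "c i \<le> sum c {..<l}" if "i < l" for c :: "nat \<Rightarrow> nat" and i l
    using that by (intro member_le_sum) auto
  \<comment> \<open>Only coordinates from \<open>M\<close> on occur, where independence covers all
    exponents up to \<open>M\<close>. The sums bound the single exponents, which is the reason for
    counting factors.\<close>
  have uniq: "c i = d i"
    if "word a c l = h \<otimes> word a d l" "h \<in> words a M" "i < l" "sum c {..<l} \<le> M" "sum d {..<l} \<le> M"
      "\<forall>i<M. c i = 0" "\<forall>i<M. d i = 0" for c d h l M i
  proof -
    let ?t = "\<lambda>c i. if i < l then c i else 0 :: nat"
    have "?t c i = ?t d i"
    proof (rule word_unique[of a, OF a tor, where M = M and r = M and h = h and n = l and c = "?t c" and d = "?t d" and i = i])
      show "word a (?t c) l = h \<otimes> word a (?t d) l"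
        using that(1) word_extend[of a, OF a, of l l c] word_extend[of a, OF a, of l l d] by simp
      show "?t c n \<le> M" for n using le[of n l c] that(4) by (auto intro: le_trans)
      show "?t d n \<le> M" for n using le[of n l d] that(5) by (auto intro: le_trans)
    qed (use that indep in auto)
    then show ?thesis using that by simp
  qed
  have sep: "j = 0 \<and> g = \<one>" if g: "\<forall>n. g \<in> B n j" for g j
  proof -
    obtain c l where c: "g = word a c l" using B_E[OF spec[OF g, of 0]] by blast
    define M where "M = max l j"
    have gM: "g \<in> words a M" using words_mono[of a, OF a, of l M] c by (auto simp: words_def M_def)
    obtain d k where d: "g = word a d k" "\<forall>i<M. d i = 0" "sum d {..<k} = j" using B_E[OF spec[OF g, of M]] by blast
    have "d i = 0" if "i < k" for i
      using uniq[of d k g "\<lambda>_. 0" M i] gM d that word_one[of a, OF a, of k "\<lambda>_. 0"] by (simp add: M_def)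
    then show ?thesis using d word_one[of a, OF a, of k d] by simp
  qed
  have clop: "\<exists>M. \<forall>i j. \<forall>w\<in>B n i. \<forall>w'\<in>B M j.
      i \<le> k \<longrightarrow> j \<le> l \<longrightarrow> w = g \<otimes> w' \<longrightarrow> (\<exists>i'. g \<in> B n i' \<and> i = i' + j)" if g: "g \<in> carrier G" for g k l n
  proof (cases "\<exists>L. g \<in> words a L")
    case False
    have "w \<noteq> g \<otimes> w'" if ww: "w \<in> B n i" "w' \<in> B 0 j" for w w' i j
    proof
      assume eq: "w = g \<otimes> w'"
      obtain c p where c: "w = word a c p" using B_E[OF ww(1)] by blast
      obtain d q where d: "w' = word a d q" using B_E[OF ww(2)] by blast
      have "w \<in> words a (max p q)" "w' \<in> words a (max p q)"
        using words_mono[of a, OF a, of p "max p q"] words_mono[of a, OF a, of q "max p q"] c d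
        by (auto simp: words_def)
      moreover have "g = w \<otimes> inv w'" using eq g d by (simp add: m_assoc)
      ultimately have "g \<in> words a (max p q)" using words_mult[of a, OF a] words_inv[of a, OF a tor] by blast
      then show False using False by blast
    qed
    then show ?thesis by blast
  next
    case True
    then obtain L where L: "g \<in> words a L" by blast
    \<comment> \<open>\<open>M\<close> lies beyond the terms occurring in \<open>g\<close> and
      dominates both degrees. Hence the part of \<open>w\<close> from \<open>M\<close> on agrees
      with \<open>w'\<close>, and \<open>g\<close> is the part before \<open>M\<close>.\<close>
    define M where "M = L + k + l"
    have gM: "g \<in> words a M" using words_mono[of a, OF a, of L M] L by (auto simp: M_def)
    have "\<exists>i'. g \<in> B n i' \<and> i = i' + j"
      if w: "w \<in> B n i" "w' \<in> B M j" "i \<le> k" "j \<le> l" "w = g \<otimes> w'" for i j w w'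
    proof -
      obtain c p where c: "w = word a c p" "\<forall>i<n. c i = 0" "sum c {..<p} = i" using B_E[OF w(1)] by blast
      obtain d q where d: "w' = word a d q" "\<forall>i<M. d i = 0" "sum d {..<q} = j" using B_E[OF w(2)] by blast
      define r where "r = M + p + q"
      define c' where "c' = (\<lambda>i. if i < p then c i else 0)"
      define d' where "d' = (\<lambda>i. if i < q then d i else 0)"
      define c2 where "c2 = (\<lambda>i. if i < M then 0 else c' i)"
      have c': "w = word a c' r" "\<forall>i<n. c' i = 0" "sum c' {..<r} = i"
        using c word_extend[of a, OF a, of p r c] sum_ext[of p r c] by (auto simp: c'_def r_def)
      have d': "w' = word a d' r" "\<forall>i<M. d' i = 0" "sum d' {..<r} = j"
        using d word_extend[of a, OF a, of q r d] sum_ext[of q r d] by (auto simp: d'_def r_def)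
      have split: "word a c' r = word a c' M \<otimes> word a c2 r"
        unfolding c2_def by (rule word_split[of a, OF a]) (simp add: r_def)
      have sums: "sum c' {..<r} = sum c' {..<M} + sum c2 {..<r}"
      proof -
        have "sum c' {..<r} = sum (\<lambda>i. (if i < M then c' i else 0) + c2 i) {..<r}"
          by (intro sum.cong) (auto simp: c2_def)
        then show ?thesis unfolding sum.distrib using sum_ext[of M r c'] by (simp add: r_def)
      qed
      define h where "h = inv (word a c' M) \<otimes> g"
      have h: "h \<in> words a M"
        unfolding h_def by (intro words_mult[of a, OF a] words_inv[of a, OF a tor] gM) (auto simp: words_def)
      have "word a c' M \<otimes> word a c2 r = g \<otimes> word a d' r" using w(5) c'(1) d'(1) split by simp
      then have eq: "word a c2 r = h \<otimes> word a d' r"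
        unfolding h_def using g by (metis a inv_solve_left m_assoc inv_closed m_closed word_closed)
      have "c2 i = d' i" if "i < r" for i
      proof (rule uniq[OF eq h that])
        show "sum c2 {..<r} \<le> M" using sums c'(3) w(3) by (simp add: M_def)
        show "sum d' {..<r} \<le> M" using d'(3) w(4) by (simp add: M_def)
      qed (use d' in \<open>auto simp: c2_def\<close>)
      then have "word a c2 r = word a d' r" "sum c2 {..<r} = sum d' {..<r}"
        by (auto intro: word_cong[of a, OF a])
      then have "word a c' M \<otimes> word a d' r = g \<otimes> word a d' r" and "i = sum c' {..<M} + j"
        using w(5) c' d' split sums by simp_all
      then have "g = word a c' M" using g by simp
      then show ?thesis using B_I[OF c'(2), of M] \<open>i = _\<close> by blast
    qed
    then show ?thesis by blast
  qed
  have "\<one> \<in> B n 0" for n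
    using B_I[of n "\<lambda>_. 0" 0] by (simp add: word_0[of a, OF a])
  moreover have "B n j \<subseteq> carrier G" for n j using B_E by force
  moreover have "B n j \<subseteq> B k j" if "k \<le> n" for k n j
    using that unfolding B_def by (auto intro: less_le_trans)
  moreover have "B n 1 \<noteq> {}" for n
    using B_I[of n "\<lambda>i. if i = n then 1 else 0" "Suc n"] by (auto simp: sum.delta)
  ultimately show thesis using B_mult sep clop by (intro that[of B])
qed

end

section \<open>The unipotent case\<close>

text \<open>Centrality of the idempotent is part of the setting; for infinite \<open>X\<close> with
  nonempty center it holds because some power of a central element is idempotent, hence equal to
  \<open>i\<close>.\<close>

locale absolutely_closed_unipotent = absolutely_closed_semigroup +
  fixes i
  assumes infinite: "infinite X" and idem_center: "i \<in> center_on X m" and idem: "m i i = i"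
    and unique: "\<lbrakk>x \<in> X; m x x = x\<rbrakk> \<Longrightarrow> x = i"
begin

lemma idem_in: "i \<in> X"
  using center_in[OF idem_center] .

lemma idem_commute: "x \<in> X \<Longrightarrow> m x i = m i x"
  using center_commute[OF idem_center] .

lemma idem_left: "\<lbrakk>x \<in> X; y \<in> X\<rbrakk> \<Longrightarrow> m x (m i y) = m i (m x y)"
  using center_left_commute[OF idem_center] .

lemma idem_idem: "x \<in> X \<Longrightarrow> m i (m i x) = m i x"
  using assoc[OF idem_in idem_in, of x] idem by simp

lemma idem_mult:
  assumes "x \<in> X" "y \<in> X"
  shows "m (m i x) (m i y) = m i (m x y)"
proof -
  have "m (m i x) (m i y) = m i (m x (m i y))"
    using assoc[OF idem_in assms(1) mem[OF idem_in assms(2)]] .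
  also have "\<dots> = m i (m x y)"
    using idem_left[OF assms] idem_idem[OF mem[OF assms]] by simp
  finally show ?thesis .
qed

lemma pow_eq_idem: "z \<in> Z \<Longrightarrow> \<exists>k. spow z k = i"
  using central_pow_idempotent[OF infinite] unique pow_in center_in by blast

definition core :: "'a monoid" where
  "core = \<lparr>carrier = {z \<in> Z. m i z = z}, monoid.mult = m, one = i\<rparr>"

lemma core_simps [simp]: "x \<otimes>\<^bsub>core\<^esub> y = m x y" "\<one>\<^bsub>core\<^esub> = i"
  by (simp_all add: core_def)

lemma coreD:
  assumes "z \<in> carrier core" shows "z \<in> Z" "z \<in> X" "m i z = z" "m z i = z"
  using assms center_in[of z] idem_commute[of z] by (auto simp: core_def)

lemma comm_group_core: "comm_group core"
proof (rule comm_groupI)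
  fix x y assume "x \<in> carrier core" "y \<in> carrier core"
  note x = coreD[OF this(1)] and y = coreD[OF this(2)]
  show "x \<otimes>\<^bsub>core\<^esub> y \<in> carrier core"
    using assoc[OF idem_in x(2) y(2)] x y center_mem by (simp add: core_def)
  show "x \<otimes>\<^bsub>core\<^esub> y = y \<otimes>\<^bsub>core\<^esub> x" using center_commute[OF y(1) x(2)] by simp
next
  show "\<one>\<^bsub>core\<^esub> \<in> carrier core" using idem_center idem by (simp add: core_def)
next
  fix x assume "x \<in> carrier core"
  note x = coreD[OF this]
  show "\<one>\<^bsub>core\<^esub> \<otimes>\<^bsub>core\<^esub> x = x" using x by simp
  obtain k where k: "spow x k = i" using pow_eq_idem[OF x(1)] by blast
  \<comment> \<open>\<open>spow x k\<close> has exponent \<open>k + 1\<close>. The inverse is taken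
    with exponent \<open>2 * k + 1\<close>, which stays positive for \<open>k = 0\<close>.\<close>
  have "m (spow x (k + k)) x = m (spow x (k + k)) (spow x 0)" by (simp add: spow_def)
  also have "\<dots> = m (spow x k) (spow x k)" by (simp add: pow_mult[OF x(2)])
  finally have "m (spow x (k + k)) x = i" using k idem by simp
  moreover have "m i (spow x n) = spow x n" for n
  proof (induction n)
    case (Suc n)
    then show ?case using assoc[OF idem_in x(2) pow_in[OF x(2)], of n] x by (simp add: pow_Suc)
  qed (simp add: spow_def x)
  ultimately show "\<exists>y\<in>carrier core. y \<otimes>\<^bsub>core\<^esub> x = \<one>\<^bsub>core\<^esub>"
    using pow_center[OF x(1), of "k + k"] by (intro bexI[of _ "spow x (k + k)"]) (auto simp: core_def)
qed (auto simp: assoc coreD)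

interpretation core: comm_group core
  by (rule comm_group_core)

lemma core_pow: "x \<in> carrier core \<Longrightarrow> x [^]\<^bsub>core\<^esub> Suc n = spow x n"
proof (induction n)
  case 0
  then show ?case by (simp add: spow_def coreD)
next
  case (Suc n)
  have "x [^]\<^bsub>core\<^esub> Suc (Suc n) = m x (x [^]\<^bsub>core\<^esub> Suc n)"
    using core.nat_pow_Suc2[OF Suc.prems, of "Suc n"] unfolding core_simps .
  then show ?case using Suc by (simp add: pow_Suc del: core.nat_pow_Suc)
qed

lemma core_torsion: "x \<in> carrier core \<Longrightarrow> \<exists>k>0. x [^]\<^bsub>core\<^esub> (k::nat) = \<one>\<^bsub>core\<^esub>"
  using pow_eq_idem[OF coreD(1)] core_pow by (metis core_simps(2) zero_less_Suc)

text \<open>Some power of every central element is \<open>i\<close>, so \<open>Z\<close> is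
  nilpotent modulo the ideal \<open>iX\<close>, while the part of \<open>Z\<close> inside
  \<open>iX\<close> is contained in the core.\<close>

lemma finite_center_if_finite_core:
  assumes "finite (carrier core)"
  shows "finite Z"
proof -
  define I where "I = {m i x |x. x \<in> X}"
  have I: "ideal_on I"
    unfolding ideal_on_def
  proof (intro conjI ballI)
    fix y x assume "y \<in> I" "x \<in> X"
    then obtain w where w: "w \<in> X" "y = m i w" by (auto simp: I_def)
    have "m y x = m i (m w x)" "m x y = m i (m x w)"
      using assoc[OF idem_in w(1) \<open>x \<in> X\<close>] idem_left[OF \<open>x \<in> X\<close> w(1)] w(2) by simp_all
    then show "m y x \<in> I" "m x y \<in> I" using w \<open>x \<in> X\<close> mem by (auto simp: I_def)
  qed (use idem_in mem in \<open>auto simp: I_def\<close>)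
  have "i \<in> I" unfolding I_def using idem idem_in by (metis (mono_tags, lifting) mem_Collect_eq)
  have "\<exists>k. spow z k \<in> I" if "z \<in> Z" for z
    using pow_eq_idem[OF that] \<open>i \<in> I\<close> by auto
  then have "finite (Z - I)"
    by (intro finite_center_minus_ideal I)
  moreover have "Z \<inter> I \<subseteq> carrier core" by (auto simp: I_def core_def idem_idem)
  then have "finite (Z \<inter> I)" using assms finite_subset by blast
  ultimately show ?thesis by (metis Un_Diff_Int finite_UnI)
qed

lemma finite_core_if_bounded:
  assumes K: "K > 0" "\<And>x. x \<in> carrier core \<Longrightarrow> x [^]\<^bsub>core\<^esub> (K::nat) = \<one>\<^bsub>core\<^esub>"
  shows "finite (carrier core)"
proof (rule ccontr)
  assume "infinite (carrier core)"
  then obtain H g where H: "\<And>n::nat. subgroup (H n) core" and g: "\<And>n. g n \<in> carrier core"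
    and coh: "\<And>n k. n \<le> k \<Longrightarrow> \<exists>h\<in>H n. g k = m h (g n)"
    and no: "\<not> (\<exists>x\<in>carrier core. \<forall>n. \<exists>h\<in>H n. x = m h (g n))"
    using core.incomplete_subgroup_filtration[OF _ K] by auto
  \<comment> \<open>Cosets of \<open>H n\<close> are compared after projection to \<open>iX\<close>,
    which defines the relation on all of \<open>X\<close>; centrality of \<open>H n\<close> makes it
    compatible with products.\<close>
  define R where "R = (\<lambda>n x y. \<exists>h\<in>H n. m i x = m h y)"
  have HX: "h \<in> carrier core" if "h \<in> H n" for h n using subgroup.mem_carrier[OF H that] .
  have Hi: "i \<in> H n" for n using subgroup.one_closed[OF H, of n] by simp
  have Hm: "m h k \<in> H n" if "h \<in> H n" "k \<in> H n" for h k n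
    using subgroup.m_closed[OF H that] by simp
  have "\<exists>y\<in>X. \<forall>n. R n y (g n)"
  proof (rule coherent_sequence_realized[OF infinite])
    fix n x show "R n x x" unfolding R_def using Hi by blast
  next
    fix n x y assume X: "x \<in> X" "y \<in> X" and "R n x y"
    then obtain h where h: "h \<in> H n" "m i x = m h y" by (auto simp: R_def)
    have hc: "h \<in> carrier core" by (rule HX[OF h(1)])
    define k where "k = inv\<^bsub>core\<^esub> h"
    have k: "k \<in> H n" unfolding k_def using subgroup.m_inv_closed[OF H h(1)] .
    have "m k h = i" using core.l_inv[OF hc] by (simp add: k_def)
    then have "m i y = m k (m h y)" using assoc coreD[OF HX[OF k]] coreD[OF hc] X by metis
    also have "\<dots> = m k x" using h(2) assoc coreD[OF HX[OF k]] idem_in X by metis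
    finally show "R n y x" using k by (auto simp: R_def)
  next
    fix n x y w assume X: "x \<in> X" "y \<in> X" "w \<in> X" and "R n x y" "R n y w"
    then obtain h k where h: "h \<in> H n" "k \<in> H n" "m i x = m h y" "m i y = m k w" by (auto simp: R_def)
    note c = coreD[OF HX[OF h(1)]] coreD[OF HX[OF h(2)]]
    have "m i x = m (m h i) y" using h c by simp
    also have "\<dots> = m h (m i y)" using c(2) idem_in X(2) by (rule assoc)
    also have "\<dots> = m h (m k w)" using h by simp
    also have "\<dots> = m (m h k) w" using c X assoc by simp
    finally show "R n x w" using Hm h by (auto simp: R_def)
  next
    fix n x y x' y' assume X: "x \<in> X" "y \<in> X" "x' \<in> X" "y' \<in> X" and "R n x x'" "R n y y'"
    then obtain h k where h: "h \<in> H n" "k \<in> H n" "m i x = m h x'" "m i y = m k y'" by (auto simp: R_def)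
    note c = coreD[OF HX[OF h(1)]] coreD[OF HX[OF h(2)]]
    have "m i (m x y) = m (m h x') (m k y')" using h idem_mult X by metis
    also have "\<dots> = m h (m k (m x' y'))"
      using c X by (simp add: assoc mem center_left_commute)
    also have "\<dots> = m (m h k) (m x' y')" using c X by (simp add: assoc mem)
    finally show "R n (m x y) (m x' y')" using Hm h by (auto simp: R_def)
  next
    fix n show "g n \<in> X" by (rule coreD[OF g])
  next
    fix n k :: nat assume "n \<le> k"
    then show "R n (g k) (g n)" using coh coreD(3)[OF g] by (simp add: R_def)
  qed
  then obtain y where y: "y \<in> X" "\<And>n. \<exists>h\<in>H n. m i y = m h (g n)" unfolding R_def by blast
  \<comment> \<open>The limit \<open>y\<close> is only known to lie in \<open>X\<close>. Its
    projection \<open>m i y\<close> is in the core by the relation at \<open>0\<close>, and is the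
    limit excluded there.\<close>
  obtain h where "h \<in> H 0" "m i y = m h (g 0)" using y by blast
  then have "m i y \<in> carrier core" using core.m_closed[OF HX g, of h 0 0] by simp
  then show False using no y by blast
qed

section \<open>The group of units of the monoid \<open>iX\<close>\<close>

definition units :: "'a set" where
  "units = {u \<in> X. m i u = u \<and> (\<exists>v\<in>X. m i v = v \<and> m u v = i)}"

text \<open>The product in the other order is idempotent, so unipotency leaves only
  \<open>i\<close>. This is why \<open>units\<close> asks for an inverse on one side only.\<close>

lemma inverse_commute:
  assumes "u \<in> X" "v \<in> X" "m i u = u" "m u v = i"
  shows "m v u = i"
proof (rule unique)
  have "m (m v u) (m v u) = m v (m (m u v) u)" using assms(1,2) by (simp add: assoc mem)
  then show "m (m v u) (m v u) = m v u" using assms by simp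
qed (use assms mem in auto)

lemma units_mult:
  assumes u: "u \<in> units" and v: "v \<in> units"
  shows "m u v \<in> units"
proof -
  obtain u' where u': "u' \<in> X" "m i u' = u'" "m u u' = i" using u by (auto simp: units_def)
  obtain v' where v': "v' \<in> X" "m i v' = v'" "m v v' = i" using v by (auto simp: units_def)
  have X: "u \<in> X" "v \<in> X" "m i u = u" "m i v = v" using u v by (auto simp: units_def)
  have "m (m u v) (m v' u') = m u (m (m v v') u')" using X(1,2) u'(1) v'(1) by (simp add: assoc mem)
  then have "m (m u v) (m v' u') = i" using u' v' by simp
  moreover have "m i (m u v) = m u v" "m i (m v' u') = m v' u'"
    using assoc[OF idem_in X(1,2)] assoc[OF idem_in v'(1) u'(1)] X u' v' by simp_all
  ultimately show ?thesis using X u' v' mem by (auto simp: units_def intro!: bexI[of _ "m v' u'"])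
qed

text \<open>Since \<open>i\<close> is the only idempotent, one-sided inverses in \<open>iX\<close> are two-sided,
  so the non-units of \<open>iX\<close> form an ideal.\<close>

lemma units_multD:
  assumes X: "p \<in> X" "q \<in> X" "m i p = p" "m i q = q" and pq: "m p q \<in> units"
  shows "p \<in> units" "q \<in> units"
proof -
  obtain v where v: "v \<in> X" "m i v = v" "m (m p q) v = i" using pq by (auto simp: units_def)
  have qv: "m q v \<in> X" "m i (m q v) = m q v" "m p (m q v) = i"
    using v X mem assoc[OF idem_in X(2) v(1)] assoc[OF X(1,2) v(1)] by simp_all
  then show "p \<in> units" using X by (auto simp: units_def)
  have "m (m q v) p = i" by (rule inverse_commute[OF X(1) qv(1) X(3) qv(3)])
  then have "m q (m v p) = i" "m v p \<in> X" "m i (m v p) = m v p"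
    using v X mem assoc[OF idem_in v(1) X(1)] by (simp_all add: assoc)
  then show "q \<in> units" using X by (auto simp: units_def)
qed

lemma core_units: "carrier core \<subseteq> units"
proof
  fix x assume x: "x \<in> carrier core"
  have "m x (inv\<^bsub>core\<^esub> x) = i" using core.r_inv[OF x] by simp
  then show "x \<in> units" using coreD[OF x] coreD[OF core.inv_closed[OF x]] by (auto simp: units_def)
qed

text \<open>If the core has unbounded exponent, adjoin to the discrete group of units of \<open>iX\<close> a central
  element \<open>y\<close>, the limit of a sequence in the core that is free enough for the powers of \<open>y\<close> to stay
  apart; \<open>None\<close> is the zero of the Rees quotient of \<open>iX\<close> by its non-units.\<close>

lemma core_bounded: "\<exists>K. \<forall>x\<in>carrier core. \<exists>k. 1 \<le> k \<and> k \<le> K \<and> x [^]\<^bsub>core\<^esub> (k::nat) = \<one>\<^bsub>core\<^esub>"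
proof (rule ccontr)
  assume "\<not> ?thesis"
  then have "\<exists>x\<in>carrier core. \<forall>k::nat. 1 \<le> k \<and> k \<le> K \<longrightarrow> x [^]\<^bsub>core\<^esub> k \<noteq> \<one>\<^bsub>core\<^esub>" for K by blast
  then obtain B :: "nat \<Rightarrow> nat \<Rightarrow> 'a set" where Bc: "\<And>n j. B n j \<subseteq> carrier core" and B1: "\<And>n. i \<in> B n 0"
    and Bm: "\<And>n j k x y. \<lbrakk>x \<in> B n j; y \<in> B n k\<rbrakk> \<Longrightarrow> m x y \<in> B n (j + k)"
    and Bmono: "\<And>k n j. k \<le> n \<Longrightarrow> B n j \<subseteq> B k j"
    and Bsep: "\<And>g j. \<forall>n. g \<in> B n j \<Longrightarrow> j = 0 \<and> g = i"
    and Bclop: "\<And>g k l n. g \<in> carrier core \<Longrightarrow> \<exists>M. \<forall>j j'. \<forall>w\<in>B n j. \<forall>w'\<in>B M j'.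
      j \<le> k \<longrightarrow> j' \<le> l \<longrightarrow> w = m g w' \<longrightarrow> (\<exists>j''. g \<in> B n j'' \<and> j = j'' + j')"
    and Bne: "\<And>n. B n 1 \<noteq> {}"
    using core.incomplete_monoid_filtration[OF core_torsion] unfolding core_simps by blast
  note Bw = subsetD[OF Bc]
  have uX: "u \<in> X" "m i u = u" "m u i = u" if "u \<in> units" for u
    using that idem_commute by (auto simp: units_def)
  have uw: "m u w \<in> units" if "u \<in> units" "w \<in> carrier core" for u w
    using units_mult that core_units by blast
  define inv' where "inv' = (\<lambda>u. SOME v. v \<in> X \<and> m i v = v \<and> m u v = i)"
  have inv': "inv' u \<in> X" "m i (inv' u) = inv' u" "m u (inv' u) = i" "m (inv' u) u = i"
    if "u \<in> units" for u
  proof -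
    have "inv' u \<in> X \<and> m i (inv' u) = inv' u \<and> m u (inv' u) = i"
      unfolding inv'_def by (rule someI_ex) (use that in \<open>auto simp: units_def\<close>)
    then show "inv' u \<in> X" "m i (inv' u) = inv' u" "m u (inv' u) = i" "m (inv' u) u = i"
      using inverse_commute uX[OF that] by auto
  qed
  \<comment> \<open>\<open>Some (u, k)\<close> stands for \<open>u\<close> times the power
    \<open>k\<close> of the new element \<open>y\<close>.\<close>
  define S where "S = insert None (Some ` (units \<times> (UNIV :: nat set)))"
  define mm where "mm = (\<lambda>x y. case (x, y) of (Some (u, k), Some (v, l)) \<Rightarrow> Some (m u v, k + l :: nat) | _ \<Rightarrow> None)"
  define h where "h = (\<lambda>x. if m i x \<in> units then Some (m i x, 0 :: nat) else None)"
  \<comment> \<open>Near \<open>u\<close> times the power \<open>k\<close> of \<open>y\<close>, some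
    of the \<open>k\<close> factors \<open>y\<close> are replaced by terms of the sequence from
    index \<open>n\<close> on. For \<open>k = 0\<close> nothing can be replaced, so the units remain
    isolated, as does \<open>None\<close>.\<close>
  define N where "N = (\<lambda>n u k. {Some (m u w, k') |w k'. \<exists>j. w \<in> B n j \<and> k = k' + j})"
  define V where "V = (\<lambda>x. case x of None \<Rightarrow> {{None}} | Some (u, k) \<Rightarrow> range (\<lambda>n. N n u k))"
  have mm_simps [simp]: "mm (Some (u, k)) (Some (v, l)) = Some (m u v, k + l)" "mm None x = None" "mm x None = None"
    for u v k l x by (auto simp: mm_def split: option.splits)
  have V_simps [simp]: "V None = {{None}}" "V (Some (u, k)) = range (\<lambda>n. N n u k)" for u k
    by (auto simp: V_def)
  have N_I: "Some (m u w, k') \<in> N n u (k' + j)" if "w \<in> B n j" for u w k' n j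
    unfolding N_def using that by blast
  have N_E: "\<exists>w k' j. x = Some (m u w, k') \<and> w \<in> B n j \<and> k = k' + j" if "x \<in> N n u k" for x n u k
    using that unfolding N_def by blast
  have self: "Some (u, k) \<in> N n u k" if "u \<in> units" for u k n
    using N_I[OF B1, of u k n] uX[OF that] by simp
  have N_S: "N n u k \<subseteq> S" if "u \<in> units" for n u k
    unfolding N_def S_def using uw[OF that] Bw by blast
  have N_mono: "N l u k \<subseteq> N n u k" if "n \<le> l" for n l u k
    unfolding N_def using Bmono[OF that] by blast
  have cancel: "w = m (inv' u) v" if "u \<in> units" "w \<in> carrier core" "v = m u w" for u v w
    using that inv'[OF that(1)] uX[OF that(1)] coreD[OF that(2)] assoc by metis
  have S_cases: "x = None \<or> (\<exists>u k. x = Some (u, k) \<and> u \<in> units)" if "x \<in> S" for x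
    using that by (auto simp: S_def)
  have sgS: "semigroup_on S mm"
    unfolding semigroup_on_def
  proof (intro conjI ballI)
    fix x y assume "x \<in> S" "y \<in> S"
    then show "mm x y \<in> S" using units_mult by (auto simp: S_def)
  next
    fix x y w assume "x \<in> S" "y \<in> S" "w \<in> S"
    then show "mm (mm x y) w = mm x (mm y w)" using uX by (auto simp: S_def assoc)
  qed
  have hom: "semigroup_hom_on X m S mm h"
    unfolding semigroup_hom_on_def
  proof (intro conjI ballI Pi_I)
    fix x assume "x \<in> X" then show "h x \<in> S" by (auto simp: h_def S_def)
  next
    fix x y assume X: "x \<in> X" "y \<in> X"
    have "m i (m x y) = m (m i x) (m i y)" using X idem_mult by simp
    \<comment> \<open>Both directions matter: the non-units of \<open>iX\<close> form an ideal, so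
      sending them to \<open>None\<close> is multiplicative.\<close>
    moreover have "m (m i x) (m i y) \<in> units \<longleftrightarrow> m i x \<in> units \<and> m i y \<in> units"
      using units_mult units_multD[of "m i x" "m i y"] mem[OF idem_in] idem_idem X by blast
    ultimately show "h (m x y) = mm (h x) (h y)" by (auto simp: h_def)
  qed
  have i_units: "i \<in> units" using idem idem_in by (auto simp: units_def)
  \<comment> \<open>This is \<open>y\<close> itself. It is approximated by image points because
    every \<open>B n 1\<close> is inhabited, whereas \<open>h\<close> takes only values with
    exponent 0.\<close>
  have "Some (i, 1) \<in> h ` X"
  proof (rule clopen_base[OF infinite sgS hom, where V = V])
    show "Some (i, 1) \<in> S" using i_units by (simp add: S_def)
  next
    fix x assume "x \<in> S" then show "V x \<noteq> {}" using S_cases by fastforce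
  next
    fix x U assume xU: "x \<in> S" "U \<in> V x"
    then consider "x = None" "U = {None}" | u k n where "u \<in> units" "x = Some (u, k)" "U = N n u k"
      using S_cases[of x] by auto
    then show "x \<in> U \<and> U \<subseteq> S"
      by cases (use xU self N_S in simp_all)
  next
    fix x U W assume "x \<in> S" and UW: "U \<in> V x" "W \<in> V x"
    show "\<exists>Q\<in>V x. Q \<subseteq> U \<inter> W"
    proof (cases x)
      case None
      then show ?thesis using UW by simp
    next
      case (Some p)
      then obtain u k n l where x: "x = Some (u, k)" "U = N n u k" "W = N l u k"
        using UW by (cases p) auto
      then have "N (max n l) u k \<subseteq> U \<inter> W" using N_mono[of n "max n l"] N_mono[of l "max n l"] by simp
      then show ?thesis using x by auto
    qed
  next
    fix x U y assume "x \<in> S" "U \<in> V x" "y \<in> U"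
    then consider "x = None" "U = {None}" "y = None"
      | u k n where "u \<in> units" "x = Some (u, k)" "U = N n u k" "y \<in> N n u k"
      using S_cases[of x] by auto
    then show "\<exists>W\<in>V y. W \<subseteq> U"
    proof cases
      case 2
      then obtain w k' j where y: "y = Some (m u w, k')" "w \<in> B n j" "k = k' + j" using N_E by blast
      have "N n (m u w) k' \<subseteq> N n u k"
      proof
        fix z assume "z \<in> N n (m u w) k'"
        then obtain w' l j' where z: "z = Some (m (m u w) w', l)" "w' \<in> B n j'" "k' = l + j'" using N_E by blast
        have "m (m u w) w' = m u (m w w')"
          using uX(1)[OF 2(1)] coreD(2)[OF Bw[OF y(2)]] coreD(2)[OF Bw[OF z(2)]] by (rule assoc)
        then show "z \<in> N n u k" using N_I[OF Bm[OF y(2) z(2)], of u l] z y by (simp add: ac_simps)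
      qed
      then show ?thesis using y 2 by auto
    qed simp
  next
    fix x U y assume xy: "x \<in> S" "U \<in> V x" "y \<in> S" "y \<notin> U"
    show "\<exists>W\<in>V y. W \<inter> U = {}"
    proof (cases "x = None \<or> y = None")
      case True
      have "None \<notin> N n u k" for n u k by (auto simp: N_def)
      then show ?thesis using True xy S_cases[of x] S_cases[of y] by auto
    next
      case False
      then obtain u k n v l where x: "x = Some (u, k)" "u \<in> units" "U = N n u k" and y: "y = Some (v, l)" "v \<in> units"
        using xy S_cases[of x] S_cases[of y] by auto
      \<comment> \<open>Neighbourhoods of points over \<open>u\<close> stay within the coset of
        \<open>u\<close> modulo the core. So if \<open>g\<close> is outside the core any two of them
        are disjoint, and otherwise \<open>Bclop\<close> supplies the index
        \<open>M\<close>.\<close>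
      define g where "g = m (inv' u) v"
      have v: "v = m u g"
        unfolding g_def using assoc[OF uX(1)[OF x(2)] inv'(1)[OF x(2)] uX(1)[OF y(2)]] inv'[OF x(2)] uX[OF y(2)] by simp
      have gX: "g \<in> X" unfolding g_def using inv'(1)[OF x(2)] uX(1)[OF y(2)] by (rule mem)
      have eqD: "w = m g w'" if "m u w = m v w'" "w \<in> carrier core" "w' \<in> carrier core" for w w'
      proof -
        have "w = m (inv' u) (m v w')" using cancel[OF x(2) that(2)] that(1) by simp
        also have "\<dots> = m g w'"
          unfolding g_def using assoc[OF inv'(1)[OF x(2)] uX(1)[OF y(2)] coreD(2)[OF that(3)]] by simp
        finally show ?thesis .
      qed
      show ?thesis
      proof (cases "g \<in> carrier core")
        case True
        then obtain M where M: "\<And>j j' w w'. \<lbrakk>w \<in> B n j; w' \<in> B M j'; j \<le> k; j' \<le> l; w = m g w'\<rbrakk>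
          \<Longrightarrow> \<exists>j''. g \<in> B n j'' \<and> j = j'' + j'" using Bclop[of g n k l] by blast
        have "N M v l \<inter> N n u k = {}"
        proof (rule ccontr)
          assume "N M v l \<inter> N n u k \<noteq> {}"
          then obtain z where z: "z \<in> N M v l" "z \<in> N n u k" by blast
          obtain w' r j' where 1: "z = Some (m v w', r)" "w' \<in> B M j'" "l = r + j'" using N_E[OF z(1)] by blast
          obtain w r' j where 2: "z = Some (m u w, r')" "w \<in> B n j" "k = r' + j" using N_E[OF z(2)] by blast
          have "w = m g w'" using eqD[of w w'] 1 2 Bw by auto
          then obtain j'' where "g \<in> B n j''" "j = j'' + j'" using M[OF 2(2) 1(2)] 1(3) 2(3) by auto
          then have "y \<in> N n u k" using N_I[of g n j'' u l] v 1 2 y(1) by (simp add: ac_simps)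
          then show False using xy(4) x(3) by simp
        qed
        then show ?thesis using x y by auto
      next
        case False
        have "N 0 v l \<inter> N n u k = {}"
        proof (rule ccontr)
          assume "N 0 v l \<inter> N n u k \<noteq> {}"
          then obtain z where z: "z \<in> N 0 v l" "z \<in> N n u k" by blast
          obtain w' r j' where 1: "z = Some (m v w', r)" "w' \<in> B 0 j'" "l = r + j'" using N_E[OF z(1)] by blast
          obtain w r' j where 2: "z = Some (m u w, r')" "w \<in> B n j" "k = r' + j" using N_E[OF z(2)] by blast
          note c = Bw[OF 1(2)] Bw[OF 2(2)]
          have "w = m g w'" using eqD[of w w'] 1 2 Bw by auto
          then have "m w (inv\<^bsub>core\<^esub> w') = m (m g w') (inv\<^bsub>core\<^esub> w')" by simp
          also have "\<dots> = m g (m w' (inv\<^bsub>core\<^esub> w'))"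
            using gX coreD(2)[OF c(1)] coreD(2)[OF core.inv_closed[OF c(1)]] by (rule assoc)
          also have "m w' (inv\<^bsub>core\<^esub> w') = i" using core.r_inv[OF c(1)] by simp
          also have "m g i = g"
            unfolding g_def using assoc[OF inv'(1)[OF x(2)] uX(1)[OF y(2)] idem_in] uX[OF y(2)] by simp
          finally show False using False core.m_closed[OF c(2) core.inv_closed[OF c(1)]] by simp
        qed
        then show ?thesis using x y by auto
      qed
    qed
  next
    fix x y assume xy: "x \<in> S" "y \<in> S" "x \<noteq> y"
    show "\<exists>U\<in>V x. y \<notin> U"
    proof (cases "x = None \<or> y = None")
      case True
      have "None \<notin> N n u k" for n u k by (auto simp: N_def)
      then show ?thesis using True xy S_cases[of x] by auto
    next
      case False
      then obtain u k v l where x: "x = Some (u, k)" "u \<in> units" and y: "y = Some (v, l)" "v \<in> units"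
        using xy S_cases[of x] S_cases[of y] by auto
      show ?thesis
      proof (rule ccontr)
        assume "\<not> ?thesis"
        then have all: "y \<in> N n u k" for n using x by auto
        \<comment> \<open>If \<open>y\<close> were in every neighbourhood of \<open>x\<close>, the
          quotient of their units would lie in all \<open>B n (k - l)\<close>, and
          \<open>Bsep\<close> would force both quotient and degree to be trivial.\<close>
        have *: "v = m u (m (inv' u) v) \<and> m (inv' u) v \<in> B n (k - l) \<and> l \<le> k" for n
        proof -
          obtain w k' j where w: "y = Some (m u w, k')" "w \<in> B n j" "k = k' + j" using N_E[OF all[of n]] by blast
          then have "w = m (inv' u) v" using cancel[OF x(2) Bw[OF w(2)]] y by simp
          then show ?thesis using w y by auto
        qed
        then have "k - l = 0 \<and> m (inv' u) v = i" by (intro Bsep) blast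
        then have "v = u" "k = l" using *[of 0] uX[OF x(2)] by auto
        then show False using x y xy by simp
      qed
    qed
  next
    fix x y U assume xy: "x \<in> S" "y \<in> S" and U: "U \<in> V (mm x y)"
    show "\<exists>P\<in>V x. \<exists>Q\<in>V y. \<forall>a\<in>P. \<forall>b\<in>Q. mm a b \<in> U"
    proof (cases "x = None \<or> y = None")
      case True
      then show ?thesis using U S_cases[OF xy(1)] S_cases[OF xy(2)] by (auto split: if_splits)
    next
      case False
      then obtain u k v l where x: "x = Some (u, k)" "u \<in> units" and y: "y = Some (v, l)" "v \<in> units"
        using xy S_cases[of x] S_cases[of y] by auto
      then obtain n where n: "U = N n (m u v) (k + l)" using U by auto
      have "mm a b \<in> U" if ab: "a \<in> N n u k" "b \<in> N n v l" for a b
      proof -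
        obtain w r j where 1: "a = Some (m u w, r)" "w \<in> B n j" "k = r + j" using N_E[OF ab(1)] by blast
        obtain w' s j' where 2: "b = Some (m v w', s)" "w' \<in> B n j'" "l = s + j'" using N_E[OF ab(2)] by blast
        note X = uX(1)[OF x(2)] uX(1)[OF y(2)] coreD(2)[OF Bw[OF 1(2)]] coreD(2)[OF Bw[OF 2(2)]]
        have "m w (m v w') = m v (m w w')"
          using center_left_commute[OF coreD(1)[OF Bw[OF 1(2)]] X(2,4)] by simp
        then have "m (m u w) (m v w') = m (m u v) (m w w')" using X by (simp add: assoc mem)
        then show ?thesis
          using N_I[OF Bm[OF 1(2) 2(2)], of "m u v" "r + s"] 1 2 n by (simp add: ac_simps)
      qed
      then show ?thesis using x y by auto
    qed
  next
    fix U assume "U \<in> V (Some (i, 1))"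
    then obtain n where n: "U = N n i 1" by auto
    obtain w where w: "w \<in> B n 1" using Bne[of n] by blast
    have c: "w \<in> carrier core" by (rule Bw[OF w])
    then have "h w = Some (m i w, 0)" using core_units coreD[OF c] by (auto simp: h_def)
    moreover have "Some (m i w, 0) \<in> U" using N_I[OF w, of i 0] n by simp
    ultimately show "U \<inter> h ` X \<noteq> {}" using coreD(2)[OF c] by force
  qed
  then show False by (auto simp: h_def split: if_splits)
qed

lemma finite_center: "finite Z"
proof -
  obtain K where K: "\<And>x. x \<in> carrier core \<Longrightarrow> \<exists>k. 1 \<le> k \<and> k \<le> K \<and> x [^]\<^bsub>core\<^esub> (k::nat) = \<one>\<^bsub>core\<^esub>"
    using core_bounded by blast
  have "x [^]\<^bsub>core\<^esub> (fact K :: nat) = \<one>\<^bsub>core\<^esub>" if x: "x \<in> carrier core" for x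
  proof -
    obtain k where k: "1 \<le> k" "k \<le> K" "x [^]\<^bsub>core\<^esub> k = \<one>\<^bsub>core\<^esub>" using K[OF x] by blast
    then obtain d where "(fact K :: nat) = k * d" using dvd_fact by blast
    then show ?thesis using k x core.nat_pow_one[of d] by (simp flip: core.nat_pow_pow)
  qed
  then have "finite (carrier core)" by (intro finite_core_if_bounded[of "fact K"]) auto
  then show ?thesis by (rule finite_center_if_finite_core)
qed

end

section \<open>Finite semigroups and the conclusion\<close>

lemma absolutely_closed_finite:
  assumes "C \<subseteq> T1S" and "semigroup_on S m" and "finite S"
  shows "absolutely_closed C S m"
  unfolding absolutely_closed_def absolutely_closed_top_def
proof (intro conjI ballI)
  show "topological_semigroup (discrete_topology S) m"
    using assms(2) by (auto simp: topological_semigroup_def semigroup_on_def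
        simp flip: prod_topology_discrete_topology)
next
  fix p assume "p \<in> C"
  then obtain T n where p: "p = (T, n)" "t1_space T" using assms(1) by (auto simp: T1S_def)
  then show "case p of (T, n) \<Rightarrow> \<forall>h. continuous_map (discrete_topology S) T h \<and>
      semigroup_hom_on (topspace (discrete_topology S)) m (topspace T) n h \<longrightarrow>
      closedin T (h ` topspace (discrete_topology S))"
    using assms(3) by (auto simp: t1_space_closedin_finite semigroup_hom_on_def)
qed

theorem corollary1p9:
  fixes X :: "'a set" and m :: "'a \<Rightarrow> 'a \<Rightarrow> 'a"
    and C :: "'b top_semigroup_class"
  assumes universe: "\<exists>e :: 'a \<Rightarrow> 'b. inj_on e X"
    and C_lower: "TzS \<subseteq> C" and C_upper: "C \<subseteq> T1S"
    and semigroup: "semigroup_on X m"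
    and unipotent: "unipotent_on X m"
    and closed: "absolutely_closed C X m"
  shows "finite (center_on X m) \<and> absolutely_closed C (center_on X m) m"
proof -
  obtain e :: "'a \<Rightarrow> 'b" where "inj_on e X" using universe by blast
  then interpret absolutely_closed_semigroup X m C e
    using C_lower closed semigroup by unfold_locales
  obtain i where i: "i \<in> X" "m i i = i" "\<And>x. \<lbrakk>x \<in> X; m x x = x\<rbrakk> \<Longrightarrow> x = i"
    using unipotent unfolding unipotent_on_def by blast
  have "finite Z"
  \<comment> \<open>The empty center is set aside because centrality of \<open>i\<close> is derived
    from the powers of some central element; infinity of \<open>X\<close> is what the tests for
    closedness require.\<close>
  proof (cases "finite X \<or> Z = {}")
    case True
    then show ?thesis using finite_subset[of Z X] center_in by auto
  next
    case False
    then obtain z where z: "z \<in> Z" by blast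
    obtain k where "m (spow z k) (spow z k) = spow z k" using central_pow_idempotent z False by blast
    then have "spow z k = i" using i(3) pow_in center_in z by blast
    then have "i \<in> Z" using pow_center[OF z] by metis
    interpret absolutely_closed_unipotent X m C e i
    proof
      show "infinite X" using False by blast
    qed (fact \<open>i \<in> Z\<close> i)+
    show ?thesis by (rule finite_center)
  qed
  then show ?thesis using absolutely_closed_finite[OF C_upper semigroup_center] by blast
qed

end
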